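(* Let $\lambda_0,\mu_0,\lambda_1,\mu_1,\varepsilon,\varepsilon',\hbar,\hbar'\in\mathbb{R}$ and $r,r'\in\mathbb{Z}$ be such that $$\lambda_0\varepsilon+\lambda_1r=-\hbar,\quad \mu_0\varepsilon'+\mu_1r'=\hbar',\quad \lambda_0\varepsilon'+\lambda_1r'=0,\quad \mu_0\varepsilon+\mu_1r=0.$$ Then $\mathcal{S}(\mathbb{R}\times\mathbb{Z})$ is a $(\mathcal{C}_\hbar^\infty,\mathcal{C}_{\hbar'}^\infty)$-bimodule with respect to the left action $$(f\xi)(x,k)=\sum_{n\in\mathbb{Z}}f_n(\lambda_0x+\lambda_1k)\,\xi(x-n\varepsilon,k-nr),\qquad f=\sum_nf_n(u)W^n\in\mathcal{C}_\hbar^\infty,$$ and the right action $$(\xi f)(x,k)=\sum_{n\in\mathbb{Z}}f_n(\mu_0x+\mu_1k-n\hbar')\,\xi(x-n\varepsilon',k-nr'),\qquad f=\sum_nf_n(u)W^n\in\mathcal{C}_{\hbar'}^\infty.$$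
   Context: For $\hbar\in\mathbb{R}$, $\mathcal{C}_\hbar^\infty$ is the vector space $\mathcal{S}(\mathbb{R}\times S^1)$ of Schwartz functions ($S^1=\mathbb{R}/\mathbb{Z}$), whose elements are written $f=\sum_{n\in\mathbb{Z}}f_n(u)W^n$ with $W=e^{2\pi it}$, $f_n\in\mathcal{S}(\mathbb{R})$, with the associative product $fg=\sum_{n}\big[\sum_{k}f_k(u)g_{n-k}(u+k\hbar)\big]W^n$. $\mathcal{S}(\mathbb{R}\times\mathbb{Z})$ is the space of Schwartz functions $\xi(x,k)$ in one real variable $x$ and one discrete variable $k$. *)

theory Defs
  imports "HOL-Analysis.Analysis" "HOL-Library.Function_Algebras"
begin

text \<open>The algebras in question have no unit, so no unitality is required of algebras
  and modules.  Algebras and modules are given by carriers inside ambient vector spaces.\<close>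

locale nonunital_algebra = vector_space scale
  for scale :: "'k::field \<Rightarrow> 'a::ab_group_add \<Rightarrow> 'a" +
  fixes A :: "'a set" and mult :: "'a \<Rightarrow> 'a \<Rightarrow> 'a"
  assumes carrier: "subspace A"
    and mult_closed: "\<lbrakk>a \<in> A; b \<in> A\<rbrakk> \<Longrightarrow> mult a b \<in> A"
    and mult_add_left: "\<lbrakk>a \<in> A; b \<in> A; c \<in> A\<rbrakk> \<Longrightarrow> mult (a + b) c = mult a c + mult b c"
    and mult_add_right: "\<lbrakk>a \<in> A; b \<in> A; c \<in> A\<rbrakk> \<Longrightarrow> mult a (b + c) = mult a b + mult a c"
    and mult_scale_left: "\<lbrakk>a \<in> A; b \<in> A\<rbrakk> \<Longrightarrow> mult (scale s a) b = scale s (mult a b)"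
    and mult_scale_right: "\<lbrakk>a \<in> A; b \<in> A\<rbrakk> \<Longrightarrow> mult a (scale s b) = scale s (mult a b)"
    and mult_assoc: "\<lbrakk>a \<in> A; b \<in> A; c \<in> A\<rbrakk> \<Longrightarrow> mult (mult a b) c = mult a (mult b c)"

locale bimodule =
  A: nonunital_algebra scaleA A multA +
  B: nonunital_algebra scaleB B multB +
  M: vector_space scaleM
  for scaleA :: "'k::field \<Rightarrow> 'a::ab_group_add \<Rightarrow> 'a" and A multA
    and scaleB :: "'k \<Rightarrow> 'b::ab_group_add \<Rightarrow> 'b" and B multB
    and scaleM :: "'k \<Rightarrow> 'm::ab_group_add \<Rightarrow> 'm" +
  fixes M :: "'m set" and lact :: "'a \<Rightarrow> 'm \<Rightarrow> 'm" and ract :: "'m \<Rightarrow> 'b \<Rightarrow> 'm"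
  assumes carrier: "M.subspace M"
    and lact_closed: "\<lbrakk>a \<in> A; x \<in> M\<rbrakk> \<Longrightarrow> lact a x \<in> M"
    and lact_add_left: "\<lbrakk>a \<in> A; a' \<in> A; x \<in> M\<rbrakk> \<Longrightarrow> lact (a + a') x = lact a x + lact a' x"
    and lact_add_right: "\<lbrakk>a \<in> A; x \<in> M; y \<in> M\<rbrakk> \<Longrightarrow> lact a (x + y) = lact a x + lact a y"
    and lact_scale_left: "\<lbrakk>a \<in> A; x \<in> M\<rbrakk> \<Longrightarrow> lact (scaleA s a) x = scaleM s (lact a x)"
    and lact_scale_right: "\<lbrakk>a \<in> A; x \<in> M\<rbrakk> \<Longrightarrow> lact a (scaleM s x) = scaleM s (lact a x)"
    and lact_assoc: "\<lbrakk>a \<in> A; a' \<in> A; x \<in> M\<rbrakk> \<Longrightarrow> lact (multA a a') x = lact a (lact a' x)"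
    and ract_closed: "\<lbrakk>x \<in> M; b \<in> B\<rbrakk> \<Longrightarrow> ract x b \<in> M"
    and ract_add_left: "\<lbrakk>x \<in> M; y \<in> M; b \<in> B\<rbrakk> \<Longrightarrow> ract (x + y) b = ract x b + ract y b"
    and ract_add_right: "\<lbrakk>x \<in> M; b \<in> B; b' \<in> B\<rbrakk> \<Longrightarrow> ract x (b + b') = ract x b + ract x b'"
    and ract_scale_left: "\<lbrakk>x \<in> M; b \<in> B\<rbrakk> \<Longrightarrow> ract (scaleM s x) b = scaleM s (ract x b)"
    and ract_scale_right: "\<lbrakk>x \<in> M; b \<in> B\<rbrakk> \<Longrightarrow> ract x (scaleB s b) = scaleM s (ract x b)"
    and ract_assoc: "\<lbrakk>x \<in> M; b \<in> B; b' \<in> B\<rbrakk> \<Longrightarrow> ract x (multB b b') = ract (ract x b) b'"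
    and lact_ract: "\<lbrakk>a \<in> A; x \<in> M; b \<in> B\<rbrakk> \<Longrightarrow> ract (lact a x) b = lact a (ract x b)"

definition scale_fun :: "complex \<Rightarrow> ('a \<Rightarrow> complex) \<Rightarrow> 'a \<Rightarrow> complex" where
  "scale_fun c f = (\<lambda>z. c * f z)"

primrec iterated_deriv ::
  "'a::euclidean_space list \<Rightarrow> ('a \<Rightarrow> 'b::real_normed_vector) \<Rightarrow> 'a \<Rightarrow> 'b" where
  "iterated_deriv [] f = f"
| "iterated_deriv (v # vs) f = (\<lambda>z. frechet_derivative (iterated_deriv vs f) (at z) v)"

text \<open>Partial derivatives of all orders are taken in every order of the variables. Each being
  (totally) differentiable makes each continuous, so this is \<open>C\<^sup>\<infinity>\<close>.\<close>

definition smooth :: "('a::euclidean_space \<Rightarrow> 'b::real_normed_vector) \<Rightarrow> bool" where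
  "smooth f \<longleftrightarrow> (\<forall>vs z. set vs \<subseteq> Basis \<longrightarrow> iterated_deriv vs f differentiable (at z))"

text \<open>Functions on \<open>\<real> \<times> S\<^sup>1\<close>, where \<open>S\<^sup>1 = \<real>/\<int>\<close>, are represented
  by functions on \<open>\<real> \<times> \<real>\<close> of period 1 in the second variable.\<close>

definition schwartz_RS :: "(real \<times> real \<Rightarrow> complex) set" where
  "schwartz_RS = {f. (\<forall>u t. f (u, t + 1) = f (u, t)) \<and> smooth f \<and>
     (\<forall>p vs. set vs \<subseteq> Basis \<longrightarrow>
        (\<exists>C. \<forall>u t. \<bar>u\<bar> ^ p * norm (iterated_deriv vs f (u, t)) \<le> C))}"

definition schwartz_RZ :: "(real \<times> int \<Rightarrow> complex) set" where
  "schwartz_RZ = {\<xi>. (\<forall>k. smooth (\<lambda>x. \<xi> (x, k))) \<and>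
     (\<forall>p q m. \<exists>C. \<forall>x k. \<bar>x\<bar> ^ p * \<bar>real_of_int k\<bar> ^ q *
        norm (iterated_deriv (replicate m 1) (\<lambda>x. \<xi> (x, k)) x) \<le> C)}"

definition W :: "real \<Rightarrow> complex" where
  "W t = exp (2 * of_real pi * \<i> * of_real t)"

text \<open>The coefficient \<open>f\<^sub>n(u)\<close> in \<open>f = \<Sum>\<^sub>n f\<^sub>n(u) W\<^sup>n\<close>, as a Fourier coefficient in \<open>t\<close>.\<close>

definition coef :: "(real \<times> real \<Rightarrow> complex) \<Rightarrow> int \<Rightarrow> real \<Rightarrow> complex" where
  "coef f n u = integral {0..1} (\<lambda>t. f (u, t) * W t powi (- n))"

text \<open>Sums over \<open>\<int>\<close> are unordered (absolutely convergent) sums.\<close>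

definition cyl_mult ::
  "real \<Rightarrow> (real \<times> real \<Rightarrow> complex) \<Rightarrow> (real \<times> real \<Rightarrow> complex) \<Rightarrow> real \<times> real \<Rightarrow> complex" where
  "cyl_mult hbar f g = (\<lambda>(u, t). \<Sum>\<^sub>\<infinity>n::int.
     (\<Sum>\<^sub>\<infinity>k::int. coef f k u * coef g (n - k) (u + of_int k * hbar)) * W t powi n)"

definition left_term ::
  "real \<Rightarrow> real \<Rightarrow> real \<Rightarrow> int \<Rightarrow> (real \<times> real \<Rightarrow> complex) \<Rightarrow> (real \<times> int \<Rightarrow> complex) \<Rightarrow>
   real \<Rightarrow> int \<Rightarrow> int \<Rightarrow> complex" where
  "left_term lam0 lam1 eps r f \<xi> x k n =
     coef f n (lam0 * x + lam1 * of_int k) * \<xi> (x - of_int n * eps, k - n * r)"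

definition left_action ::
  "real \<Rightarrow> real \<Rightarrow> real \<Rightarrow> int \<Rightarrow> (real \<times> real \<Rightarrow> complex) \<Rightarrow> (real \<times> int \<Rightarrow> complex) \<Rightarrow>
   real \<times> int \<Rightarrow> complex" where
  "left_action lam0 lam1 eps r f \<xi> = (\<lambda>(x, k). \<Sum>\<^sub>\<infinity>n. left_term lam0 lam1 eps r f \<xi> x k n)"

definition right_term ::
  "real \<Rightarrow> real \<Rightarrow> real \<Rightarrow> real \<Rightarrow> int \<Rightarrow> (real \<times> int \<Rightarrow> complex) \<Rightarrow> (real \<times> real \<Rightarrow> complex) \<Rightarrow>
   real \<Rightarrow> int \<Rightarrow> int \<Rightarrow> complex" where
  "right_term mu0 mu1 hbar eps r \<xi> f x k n =
     coef f n (mu0 * x + mu1 * of_int k - of_int n * hbar) * \<xi> (x - of_int n * eps, k - n * r)"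

definition right_action ::
  "real \<Rightarrow> real \<Rightarrow> real \<Rightarrow> real \<Rightarrow> int \<Rightarrow> (real \<times> int \<Rightarrow> complex) \<Rightarrow> (real \<times> real \<Rightarrow> complex) \<Rightarrow>
   real \<times> int \<Rightarrow> complex" where
  "right_action mu0 mu1 hbar eps r \<xi> f =
     (\<lambda>(x, k). \<Sum>\<^sub>\<infinity>n. right_term mu0 mu1 hbar eps r \<xi> f x k n)"

end

theory Submission
  imports Defs
begin

text \<open>Everything is read off from Fourier coefficients. The coefficient sequence of an element of
  \<open>\<S>(\<real> \<times> S\<^sup>1)\<close> lies in \<open>\<S>(\<real> \<times> \<int>)\<close>, and a sequence in \<open>\<S>(\<real> \<times> \<int>)\<close> sums to an element of
  \<open>\<S>(\<real> \<times> S\<^sup>1)\<close> with these coefficients. On coefficients, the left action, the right action and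
  the product are all instances of one twisted action of \<open>\<S>(\<real> \<times> \<int>)\<close> on itself,
  \<open>(a \<xi>)(x, k) = \<Sum>\<^sub>n a(\<alpha> x + \<beta> k + \<gamma> n, n) \<xi>(x - n \<epsilon>, k - n r)\<close>: the left action has \<open>\<gamma> = 0\<close>, the right
  action \<open>\<gamma> = - \<hbar>'\<close>, and the product \<open>\<alpha> = r = 1\<close>, \<open>\<beta> = \<gamma> = 0\<close>, \<open>\<epsilon> = - \<hbar>\<close>. Two consecutive actions are
  an absolutely convergent double sum, and the four numerical hypotheses say how the argument
  \<open>\<alpha> x + \<beta> k\<close> of one action moves under the shift made by another. Associativity of the product is
  a special case of associativity of the left action.\<close>


section \<open>Iterated derivatives and termwise differentiation of series over the integers\<close>

lemma vector_space_scale_fun: "vector_space scale_fun"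
  by unfold_locales (auto simp: scale_fun_def fun_eq_iff algebra_simps)

lemma iterated_deriv_append:
  "iterated_deriv (vs @ ws) f = iterated_deriv vs (iterated_deriv ws f)"
  by (induction vs) auto

lemma iterated_deriv_invariant:
  assumes step: "\<And>g v. \<lbrakk>P g; v \<in> Basis\<rbrakk> \<Longrightarrow> P (iterated_deriv [v] g)"
    and "P f" "set vs \<subseteq> Basis"
  shows "P (iterated_deriv vs f)"
  using assms(3)
proof (induction vs)
  case (Cons v vs)
  then have "P (iterated_deriv [v] (iterated_deriv vs f))"
    by (intro step) auto
  then show ?case by simp
qed (simp add: \<open>P f\<close>)

lemma smooth_differentiable: "smooth f \<Longrightarrow> f differentiable (at z)"
  unfolding smooth_def by (auto dest: spec[of _ "[]"])

lemma smooth_iterated_deriv: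
  assumes "smooth f" "set ws \<subseteq> Basis"
  shows "smooth (iterated_deriv ws f)"
  unfolding smooth_def
proof (intro allI impI)
  fix vs :: "'a list" and z assume "set vs \<subseteq> Basis"
  with assms have "iterated_deriv (vs @ ws) f differentiable (at z)"
    unfolding smooth_def by (metis Un_least set_append)
  then show "iterated_deriv vs (iterated_deriv ws f) differentiable (at z)"
    by (simp add: iterated_deriv_append)
qed

lemma iterated_deriv_real:
  fixes f :: "real \<Rightarrow> 'b::real_normed_vector"
  assumes "\<And>x. (f has_vector_derivative f' x) (at x)"
  shows "iterated_deriv [1] f = f'"
proof
  fix x
  have "frechet_derivative f (at x) = (\<lambda>h. h *\<^sub>R f' x)"
    using assms[of x] frechet_derivative_at unfolding has_vector_derivative_def by metis
  then show "iterated_deriv [1] f x = f' x" by simp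
qed

lemma has_vector_derivative_iterated_deriv_real:
  fixes f :: "real \<Rightarrow> 'b::real_normed_vector"
  assumes "f differentiable (at x)"
  shows "(f has_vector_derivative iterated_deriv [1] f x) (at x)"
proof -
  obtain d where d: "(f has_vector_derivative d) (at x)"
    using assms by (metis vector_derivative_works)
  then have "frechet_derivative f (at x) = (\<lambda>h. h *\<^sub>R d)"
    using frechet_derivative_at unfolding has_vector_derivative_def by metis
  with d show ?thesis by simp
qed

text \<open>On the line the only basis vector is 1, so a list of directions is known by its length.
  This links \<open>smooth\<close>, which quantifies over lists of directions, with
  \<open>schwartz_RZ\<close>, which counts derivatives.\<close>

lemma set_subset_Basis_real_iff:
  "set vs \<subseteq> (Basis :: real set) \<longleftrightarrow> vs = replicate (length vs) 1"
proof
  assume "set vs \<subseteq> (Basis :: real set)"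
  then show "vs = replicate (length vs) 1"
    by (intro replicate_length_same[symmetric]) auto
next
  assume *: "vs = replicate (length vs) 1"
  show "set vs \<subseteq> (Basis :: real set)"
    by (subst *) auto
qed

text \<open>Weierstrass M-test for derivatives. The integers are enumerated by a bijection
  \<open>b\<close> with the naturals, which turns the unordered sum into an ordinary series with the
  same value; the majorant \<open>M\<close> makes the series of derivatives converge
  uniformly.\<close>

lemma has_derivative_infsum:
  fixes f :: "int \<Rightarrow> 'a::real_normed_vector \<Rightarrow> 'b::banach"
  assumes deriv: "\<And>n x. (f n has_derivative f' n x) (at x)"
    and bound: "\<And>n x h. norm (f' n x h) \<le> M n * norm h"
    and M: "M summable_on UNIV"
    and f: "\<And>x. (\<lambda>n. f n x) summable_on UNIV"
  shows "((\<lambda>x. \<Sum>\<^sub>\<infinity>n. f n x) has_derivative (\<lambda>h. \<Sum>\<^sub>\<infinity>n. f' n x h)) (at x)"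
proof -
  define b where "b = int_decode"
  have b: "bij b" by (simp add: b_def bij_int_decode)
    have toS: "(\<lambda>i. g (b i)) sums (\<Sum>\<^sub>\<infinity>n. g n)" if "g summable_on UNIV" for g :: "int \<Rightarrow> 'c::banach"
    proof -
      have "((\<lambda>i. g (b i)) has_sum (\<Sum>\<^sub>\<infinity>n. g n)) UNIV"
        using that b by (simp add: has_sum_reindex_bij_betw)
      then show ?thesis by (rule has_sum_imp_sums)
    qed
    have sM: "summable (\<lambda>i. M (b i))" using toS[OF M] sums_summable by blast
    have absf': "(\<lambda>n. norm (f' n x h)) summable_on UNIV" for x h
      by (rule Infinite_Sum.abs_summable_on_comparison_test'[where g = "\<lambda>n. M n * norm h"])
        (use M bound in \<open>auto intro: summable_on_cmult_left\<close>)
    then have f's: "(\<lambda>n. f' n x h) summable_on UNIV" for x h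
      by (rule abs_summable_summable)
    \<comment> \<open>Uniform convergence of the derivatives as linear maps: the remainder after
      \<open>N\<close> terms is at most the tail of the majorant times \<open>norm h\<close>,
      whatever \<open>x\<close> is.\<close>
    have ev: "\<forall>\<^sub>F N in sequentially. \<forall>x\<in>UNIV. \<forall>h.
        norm ((\<Sum>i<N. f' (b i) x h) - (\<Sum>\<^sub>\<infinity>n. f' n x h)) \<le> e * norm h" if "e > 0" for e
    proof -
      have "(\<lambda>N. \<Sum>i. M (b (i + N))) \<longlonglongrightarrow> 0"
        by (rule suminf_exist_split2[OF sM])
      then have "\<forall>\<^sub>F N in sequentially. (\<Sum>i. M (b (i + N))) < e"
        using that by (rule order_tendstoD)
      then show ?thesis
      proof eventually_elim
        case (elim N)
        show ?case
        proof (intro ballI allI)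
          fix x h
          have s: "(\<lambda>i. f' (b i) x h) sums (\<Sum>\<^sub>\<infinity>n. f' n x h)" by (rule toS[OF f's])
          have sM': "summable (\<lambda>i. M (b (i + N)) * norm h)"
            by (intro summable_mult2) (simp add: sM summable_iff_shift[of "\<lambda>i. M (b i)"])
          have "(\<Sum>\<^sub>\<infinity>n. f' n x h) - (\<Sum>i<N. f' (b i) x h) = (\<Sum>i. f' (b (i + N)) x h)"
            using suminf_minus_initial_segment[OF sums_summable[OF s], of N] sums_unique[OF s]
            by simp
          also have "norm \<dots> \<le> (\<Sum>i. M (b (i + N)) * norm h)"
            by (rule norm_suminf_le[OF bound sM'])
          also have "\<dots> = (\<Sum>i. M (b (i + N))) * norm h"
            by (rule suminf_mult2[symmetric]) (simp add: sM summable_iff_shift[of "\<lambda>i. M (b i)"])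
          also have "\<dots> \<le> e * norm h" using elim by (intro mult_right_mono) auto
          finally show "norm ((\<Sum>i<N. f' (b i) x h) - (\<Sum>\<^sub>\<infinity>n. f' n x h)) \<le> e * norm h"
            by (simp add: norm_minus_commute)
        qed
      qed
    qed
    \<comment> \<open>Termwise differentiation yields some limit function \<open>g\<close>;
      uniqueness of sums then identifies it with the unordered sum.\<close>
    have "\<exists>g. \<forall>x\<in>UNIV. (\<lambda>i. f (b i) x) sums g x \<and>
        (g has_derivative (\<lambda>h. \<Sum>\<^sub>\<infinity>n. f' n x h)) (at x within UNIV)"
      by (rule has_derivative_series[where f = "\<lambda>i. f (b i)" and f' = "\<lambda>i. f' (b i)"
            and x = x and l = "\<Sum>\<^sub>\<infinity>n. f n x"])
        (use deriv ev toS[OF f] in auto)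
    then obtain g where g: "\<And>x. (\<lambda>i. f (b i) x) sums g x"
      "\<And>x. (g has_derivative (\<lambda>h. \<Sum>\<^sub>\<infinity>n. f' n x h)) (at x)" by auto
    have "g = (\<lambda>x. \<Sum>\<^sub>\<infinity>n. f n x)"
      using g(1) toS[OF f] sums_unique2 by blast
    with g(2) show ?thesis by simp
qed

lemma has_vector_derivative_infsum:
  fixes f :: "int \<Rightarrow> real \<Rightarrow> 'b::banach"
  assumes "\<And>n x. (f n has_vector_derivative f' n x) (at x)"
    and "\<And>n x. norm (f' n x) \<le> M n" and "M summable_on UNIV"
    and "\<And>x. (\<lambda>n. f n x) summable_on UNIV"
  shows "((\<lambda>x. \<Sum>\<^sub>\<infinity>n. f n x) has_vector_derivative (\<Sum>\<^sub>\<infinity>n. f' n x)) (at x)"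
proof -
  have "((\<lambda>x. \<Sum>\<^sub>\<infinity>n. f n x) has_derivative (\<lambda>h. \<Sum>\<^sub>\<infinity>n. h *\<^sub>R f' n x)) (at x)"
    by (rule has_derivative_infsum[where M = M])
      (use assms in \<open>auto simp: has_vector_derivative_def mult.commute intro!: mult_left_mono\<close>)
  then show ?thesis
    by (simp add: has_vector_derivative_def infsum_scaleR_right)
qed

text \<open>The one summable majorant used for all series. The summand 1 keeps the denominator away
  from 0 at \<open>n = 0\<close>, and the exponent 2 is paid for by two extra powers of
  decay.\<close>

definition weight :: "int \<Rightarrow> real" where
  "weight n = 1 / (1 + \<bar>of_int n\<bar>) ^ 2"

lemma weight_pos: "weight n > 0"
  by (simp add: weight_def)

text \<open>The weight is even, so both halves of the integers reduce to the series of inverse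
  squares. The halves overlap in 0, which is harmless for summability.\<close>

lemma summable_weight: "weight summable_on UNIV"
proof -
  have 1: "(\<lambda>n::nat. weight (int n)) summable_on UNIV"
  proof (rule norm_summable_imp_summable_on)
    have "summable (\<lambda>n. inverse ((real (Suc n))\<^sup>2))"
      unfolding summable_Suc_iff[of "\<lambda>n. inverse ((real n)\<^sup>2)"]
      by (rule inverse_power_summable) simp
    then show "summable (\<lambda>n. norm (weight (int n)))"
      by (simp add: weight_def inverse_eq_divide add.commute)
  qed
  have "weight summable_on range int"
    using 1 by (subst summable_on_reindex) (auto simp: o_def inj_on_def)
  moreover have "weight summable_on range (\<lambda>n. - int n)"
    using 1 by (subst summable_on_reindex) (auto simp: o_def inj_on_def weight_def)
  moreover have "(UNIV :: int set) = range int \<union> range (\<lambda>n. - int n)"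
  proof -
    have "z \<in> range int \<union> range (\<lambda>n. - int n)" for z
      by (cases z rule: int_cases2) auto
    then show ?thesis by blast
  qed
  ultimately show ?thesis
    using summable_on_union[of weight "range int" "range (\<lambda>n. - int n)"] by simp
qed

section \<open>Decaying functions and \<open>\<S>(\<real> \<times> \<int>)\<close>\<close>


text \<open>Rapid decay without smoothness, which is all that convergence and rearrangement of the
  sums require. The factors \<open>1 + \<bar>x\<bar>\<close> never vanish, so they can be divided
  by, and they behave well under shifts.\<close>

definition decaying :: "(real \<times> int \<Rightarrow> complex) \<Rightarrow> bool" where
  "decaying f \<longleftrightarrow> (\<forall>p q. \<exists>C. \<forall>x k.
     (1 + \<bar>x\<bar>) ^ p * (1 + \<bar>real_of_int k\<bar>) ^ q * norm (f (x, k)) \<le> C)"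

lemma one_plus_power_le:
  fixes s :: real
  assumes "s \<ge> 0"
  shows "(1 + s) ^ p \<le> 2 ^ p * (1 + s ^ p)"
proof -
  have "(1 + s) ^ p \<le> (2 * max 1 s) ^ p"
    using assms by (intro power_mono) auto
  also have "\<dots> \<le> 2 ^ p * (1 + s ^ p)"
    using assms by (auto simp: power_mult_distrib max_def intro!: mult_left_mono)
  finally show ?thesis .
qed

text \<open>Translates to the form of the bound in \<open>schwartz_RZ\<close>. For the converse,
  each power of \<open>1 + s\<close> is at most a constant times \<open>1 + s ^ p\<close>, and the
  product expands into four monomials, each with its own bound.\<close>

lemma decaying_iff:
  "decaying f \<longleftrightarrow>
    (\<forall>p q. \<exists>C. \<forall>x k. \<bar>x\<bar> ^ p * \<bar>real_of_int k\<bar> ^ q * norm (f (x, k)) \<le> C)"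
  (is "_ \<longleftrightarrow> ?R")
proof
  assume f: "decaying f"
  show ?R
  proof (intro allI)
    fix p q
    from f obtain C where
      C: "\<And>x k. (1 + \<bar>x\<bar>) ^ p * (1 + \<bar>real_of_int k\<bar>) ^ q * norm (f (x, k)) \<le> C"
      unfolding decaying_def by metis
    have "\<bar>x\<bar> ^ p * \<bar>real_of_int k\<bar> ^ q * norm (f (x, k)) \<le> C" for x k
      by (rule order_trans[OF _ C[of x k]]) (intro mult_mono power_mono; simp)
    then show "\<exists>C. \<forall>x k. \<bar>x\<bar> ^ p * \<bar>real_of_int k\<bar> ^ q * norm (f (x, k)) \<le> C" by blast
  qed
next
  assume f: ?R
  show "decaying f"
    unfolding decaying_def
  proof (intro allI)
    fix p q
    obtain C where
      C: "\<And>p q x k. \<bar>x\<bar> ^ p * \<bar>real_of_int k\<bar> ^ q * norm (f (x, k)) \<le> C p q"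
      using f by metis
    have "(1 + \<bar>x\<bar>) ^ p * (1 + \<bar>real_of_int k\<bar>) ^ q * norm (f (x, k))
        \<le> 2 ^ p * 2 ^ q * (C 0 0 + C p 0 + C 0 q + C p q)" for x k
    proof -
      let ?N = "norm (f (x, k))" and ?k = "\<bar>real_of_int k\<bar>"
      have "(1 + \<bar>x\<bar>) ^ p * (1 + ?k) ^ q * ?N
          \<le> (2 ^ p * (1 + \<bar>x\<bar> ^ p)) * (2 ^ q * (1 + ?k ^ q)) * ?N"
        by (intro mult_mono one_plus_power_le) auto
      also have "\<dots> = 2 ^ p * 2 ^ q * (?N + \<bar>x\<bar> ^ p * ?N + ?k ^ q * ?N + \<bar>x\<bar> ^ p * ?k ^ q * ?N)"
        by (simp add: algebra_simps)
      also have "\<dots> \<le> 2 ^ p * 2 ^ q * (C 0 0 + C p 0 + C 0 q + C p q)"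
        using C[of x 0 k 0] C[of x p k 0] C[of x 0 k q] C[of x p k q]
        by (intro mult_left_mono add_mono) auto
      finally show ?thesis .
    qed
    then show "\<exists>C. \<forall>x k. (1 + \<bar>x\<bar>) ^ p * (1 + \<bar>real_of_int k\<bar>) ^ q * norm (f (x, k)) \<le> C"
      by blast
  qed
qed

text \<open>Two powers of \<open>1 + \<bar>n\<bar>\<close> beyond \<open>q\<close> are spent on the
  factor \<open>weight n\<close>.\<close>

lemma decaying_weight:
  assumes "decaying f"
  obtains C where "C \<ge> 0"
    "\<And>x n. (1 + \<bar>x\<bar>) ^ p * (1 + \<bar>real_of_int n\<bar>) ^ q * norm (f (x, n)) \<le> C * weight n"
proof -
  obtain C where
    C: "\<And>x n. (1 + \<bar>x\<bar>) ^ p * (1 + \<bar>real_of_int n\<bar>) ^ (q + 2) * norm (f (x, n)) \<le> C"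
    using assms unfolding decaying_def by metis
  show thesis
  proof
    \<comment> \<open>Reading the bound at the origin shows that the constant is
      nonnegative.\<close>
    have "0 \<le> (1 + \<bar>0\<bar>) ^ p * (1 + \<bar>real_of_int 0\<bar>) ^ (q + 2) * norm (f (0, 0))" by simp
    also have "\<dots> \<le> C" by (rule C)
    finally show "C \<ge> 0" .
    fix x n
    have "(1 + \<bar>real_of_int n\<bar>)\<^sup>2 > 0" by simp
    with C[of x n] show "(1 + \<bar>x\<bar>) ^ p * (1 + \<bar>real_of_int n\<bar>) ^ q * norm (f (x, n)) \<le> C * weight n"
      unfolding weight_def power_add by (simp add: field_simps)
  qed
qed

lemma decaying_bounded:
  assumes "decaying f"
  obtains C where "C \<ge> 0" "\<And>x n. norm (f (x, n)) \<le> C"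
proof -
  obtain C where C: "\<And>x n. (1 + \<bar>x\<bar>) ^ 0 * (1 + \<bar>real_of_int n\<bar>) ^ 0 * norm (f (x, n)) \<le> C"
    using assms unfolding decaying_def by metis
  then have "norm (f (x, n)) \<le> C" for x n by (metis mult_1 power_0)
  then show thesis using that norm_ge_zero order_trans by metis
qed

lemma decaying_weight_bounded:
  assumes "decaying f"
  obtains C where "C \<ge> 0" "\<And>x n. norm (f (x, n)) \<le> C * weight n"
  using decaying_weight[OF assms, of 0 0] by auto

lemma decaying_add:
  assumes "decaying f" "decaying g"
  shows "decaying (f + g)"
  unfolding decaying_def
proof (intro allI)
  fix p q
  obtain C D where
    C: "\<And>x k. (1 + \<bar>x\<bar>) ^ p * (1 + \<bar>real_of_int k\<bar>) ^ q * norm (f (x, k)) \<le> C" and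
    D: "\<And>x k. (1 + \<bar>x\<bar>) ^ p * (1 + \<bar>real_of_int k\<bar>) ^ q * norm (g (x, k)) \<le> D"
    using assms unfolding decaying_def by metis
  have "(1 + \<bar>x\<bar>) ^ p * (1 + \<bar>real_of_int k\<bar>) ^ q * norm ((f + g) (x, k)) \<le> C + D" for x k
  proof -
    have "(1 + \<bar>x\<bar>) ^ p * (1 + \<bar>real_of_int k\<bar>) ^ q * norm ((f + g) (x, k)) \<le>
        (1 + \<bar>x\<bar>) ^ p * (1 + \<bar>real_of_int k\<bar>) ^ q * (norm (f (x, k)) + norm (g (x, k)))"
      by (intro mult_left_mono) (auto simp: norm_triangle_ineq)
    then show ?thesis using C[of x k] D[of x k] by (simp add: algebra_simps)
  qed
  then show "\<exists>C. \<forall>x k. (1 + \<bar>x\<bar>) ^ p * (1 + \<bar>real_of_int k\<bar>) ^ q * norm ((f + g) (x, k)) \<le> C"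
    by blast
qed

lemma decaying_scale:
  assumes "decaying f"
  shows "decaying (scale_fun c f)"
  unfolding decaying_def
proof (intro allI)
  fix p q
  obtain C where
    C: "\<And>x k. (1 + \<bar>x\<bar>) ^ p * (1 + \<bar>real_of_int k\<bar>) ^ q * norm (f (x, k)) \<le> C"
    using assms unfolding decaying_def by metis
  have "(1 + \<bar>x\<bar>) ^ p * (1 + \<bar>real_of_int k\<bar>) ^ q * norm (scale_fun c f (x, k)) \<le> norm c * C" for x k
    using mult_left_mono[OF C[of x k], of "norm c"]
    by (simp add: scale_fun_def norm_mult mult_ac)
  then show "\<exists>C. \<forall>x k. (1 + \<bar>x\<bar>) ^ p * (1 + \<bar>real_of_int k\<bar>) ^ q * norm (scale_fun c f (x, k)) \<le> C"
    by blast
qed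

lemma decaying_0: "decaying 0"
  unfolding decaying_def by auto

section \<open>The derivative in the real variable and a coinduction principle for the Schwartz
  space\<close>

definition dx :: "(real \<times> int \<Rightarrow> complex) \<Rightarrow> real \<times> int \<Rightarrow> complex" where
  "dx \<xi> = (\<lambda>(x, k). iterated_deriv [1] (\<lambda>x. \<xi> (x, k)) x)"

lemma schwartz_RZ_decaying: "\<xi> \<in> schwartz_RZ \<Longrightarrow> decaying \<xi>"
  unfolding schwartz_RZ_def decaying_iff
  by (auto dest: spec[of _ 0] simp: all_conj_distrib)
    (metis iterated_deriv.simps(1) replicate_0)

lemma schwartz_RZ_has_vector_derivative:
  "\<xi> \<in> schwartz_RZ \<Longrightarrow> ((\<lambda>x. \<xi> (x, k)) has_vector_derivative dx \<xi> (x, k)) (at x)"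
  using has_vector_derivative_iterated_deriv_real[OF smooth_differentiable, of "\<lambda>x. \<xi> (x, k)" x]
  by (simp add: dx_def schwartz_RZ_def)

text \<open>The derivative in \<open>dx\<close> is applied first, while
  \<open>replicate (Suc m) 1\<close> adds its extra derivative last; all directions being equal, the
  two lists coincide.\<close>

lemma iterated_deriv_dx:
  "iterated_deriv (replicate m 1) (\<lambda>x. dx \<xi> (x, k)) =
   iterated_deriv (replicate (Suc m) 1) (\<lambda>x. \<xi> (x, k))"
proof -
  have "iterated_deriv (replicate m 1) (\<lambda>x. dx \<xi> (x, k)) =
      iterated_deriv (replicate m 1 @ [1]) (\<lambda>x. \<xi> (x, k))"
    by (simp add: iterated_deriv_append dx_def del: iterated_deriv.simps)
  then show ?thesis by (simp add: replicate_append_same del: iterated_deriv.simps)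
qed

lemma schwartz_RZ_dx:
  assumes "\<xi> \<in> schwartz_RZ"
  shows "dx \<xi> \<in> schwartz_RZ"
proof -
  have "smooth (\<lambda>x. dx \<xi> (x, k))" for k
    using smooth_iterated_deriv[of "\<lambda>x. \<xi> (x, k)" "[1]"] assms
    by (simp add: schwartz_RZ_def dx_def del: iterated_deriv.simps)
  moreover have "\<exists>C. \<forall>x k. \<bar>x\<bar> ^ p * \<bar>real_of_int k\<bar> ^ q *
        norm (iterated_deriv (replicate m 1) (\<lambda>x. dx \<xi> (x, k)) x) \<le> C" for p q m
    using assms unfolding iterated_deriv_dx schwartz_RZ_def by blast
  ultimately show ?thesis unfolding schwartz_RZ_def by blast
qed

text \<open>By induction on the order, every iterated derivative of a member is again in
  \<open>S\<close>, which yields smoothness and all decay bounds at once. Membership proofs then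
  need no formula for higher derivatives, only a family of decaying functions closed under the first
  one.\<close>

lemma schwartz_RZ_coinduct:
  assumes "\<xi> \<in> S"
    and decay: "\<And>\<eta>. \<eta> \<in> S \<Longrightarrow> decaying \<eta>"
    and deriv: "\<And>\<eta>. \<eta> \<in> S \<Longrightarrow>
      \<exists>d\<in>S. \<forall>x k. ((\<lambda>x. \<eta> (x, k)) has_vector_derivative d (x, k)) (at x)"
  shows "\<xi> \<in> schwartz_RZ"
proof -
  \<comment> \<open>A single \<open>d\<close> has to serve all \<open>k\<close>, since the decay
    bounds are uniform in \<open>k\<close>.\<close>
  have ex: "\<exists>d\<in>S. \<forall>k. iterated_deriv (replicate m 1) (\<lambda>x. \<xi> (x, k)) = (\<lambda>x. d (x, k))" for m
  proof (induction m)
    case 0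
    then show ?case using assms(1) by auto
  next
    case (Suc m)
    then obtain d where d: "d \<in> S"
      "\<And>k. iterated_deriv (replicate m 1) (\<lambda>x. \<xi> (x, k)) = (\<lambda>x. d (x, k))" by blast
    obtain d' where d': "d' \<in> S"
      "\<And>x k. ((\<lambda>x. d (x, k)) has_vector_derivative d' (x, k)) (at x)"
      using deriv[OF d(1)] by blast
    have "iterated_deriv (replicate (Suc m) 1) (\<lambda>x. \<xi> (x, k)) =
        iterated_deriv [1] (iterated_deriv (replicate m 1) (\<lambda>x. \<xi> (x, k)))" for k
      by simp
    also have "\<dots> k = (\<lambda>x. d' (x, k))" for k
      unfolding d(2) by (rule iterated_deriv_real[OF d'(2)])
    finally show ?case using d'(1) by blast
  qed
  have "smooth (\<lambda>x. \<xi> (x, k))" for k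
    unfolding smooth_def
  proof (intro allI impI)
    fix vs :: "real list" and z assume "set vs \<subseteq> Basis"
    then have "vs = replicate (length vs) 1"
      by (simp only: set_subset_Basis_real_iff)
    then obtain d where d: "d \<in> S" "iterated_deriv vs (\<lambda>x. \<xi> (x, k)) = (\<lambda>x. d (x, k))"
      using ex[of "length vs"] by metis
    show "iterated_deriv vs (\<lambda>x. \<xi> (x, k)) differentiable at z"
      using deriv[OF d(1)] unfolding d(2) by (blast intro: differentiableI_vector)
  qed
  moreover have "\<exists>C. \<forall>x k. \<bar>x\<bar> ^ p * \<bar>real_of_int k\<bar> ^ q *
        norm (iterated_deriv (replicate m 1) (\<lambda>x. \<xi> (x, k)) x) \<le> C" for p q m
  proof -
    obtain d where d: "d \<in> S"
      "\<And>k. iterated_deriv (replicate m 1) (\<lambda>x. \<xi> (x, k)) = (\<lambda>x. d (x, k))"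
      using ex by blast
    then show ?thesis using decay[OF d(1)] unfolding decaying_iff by simp
  qed
  ultimately show ?thesis unfolding schwartz_RZ_def by blast
qed

text \<open>The family of all sums of two Schwartz functions and the family of all multiples by a
  fixed scalar are closed under differentiation, so coinduction applies to each.\<close>

lemma subspace_schwartz_RZ: "module.subspace scale_fun schwartz_RZ"
proof -
  interpret vector_space scale_fun by (rule vector_space_scale_fun)
  show ?thesis
  proof (rule subspaceI)
    show "0 \<in> schwartz_RZ"
      by (rule schwartz_RZ_coinduct[of _ "{0}"]) (auto simp: decaying_0)
  next
    fix f g assume fg: "f \<in> schwartz_RZ" "g \<in> schwartz_RZ"
    show "f + g \<in> schwartz_RZ"
    proof (rule schwartz_RZ_coinduct[of _ "{f + g |f g. f \<in> schwartz_RZ \<and> g \<in> schwartz_RZ}"])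
      fix \<eta> assume "\<eta> \<in> {f + g |f g. f \<in> schwartz_RZ \<and> g \<in> schwartz_RZ}"
      then obtain f g where \<eta>: "\<eta> = f + g" "f \<in> schwartz_RZ" "g \<in> schwartz_RZ" by blast
      then show "decaying \<eta>" by (simp add: decaying_add schwartz_RZ_decaying)
      have "((\<lambda>x. \<eta> (x, k)) has_vector_derivative (dx f + dx g) (x, k)) (at x)" for x k
        using \<eta> by (auto intro: has_vector_derivative_add schwartz_RZ_has_vector_derivative)
      then show "\<exists>d\<in>{f + g |f g. f \<in> schwartz_RZ \<and> g \<in> schwartz_RZ}.
          \<forall>x k. ((\<lambda>x. \<eta> (x, k)) has_vector_derivative d (x, k)) (at x)"
        using \<eta> schwartz_RZ_dx by blast
    qed (use fg in blast)
  next
    fix c f assume f: "f \<in> schwartz_RZ"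
    show "scale_fun c f \<in> schwartz_RZ"
    proof (rule schwartz_RZ_coinduct[of _ "scale_fun c ` schwartz_RZ"])
      fix \<eta> assume "\<eta> \<in> scale_fun c ` schwartz_RZ"
      then obtain f where \<eta>: "\<eta> = scale_fun c f" "f \<in> schwartz_RZ" by blast
      then show "decaying \<eta>" by (simp add: decaying_scale schwartz_RZ_decaying)
      have "((\<lambda>x. \<eta> (x, k)) has_vector_derivative scale_fun c (dx f) (x, k)) (at x)" for x k
        using \<eta> unfolding scale_fun_def
        by (auto intro: has_vector_derivative_mult_right schwartz_RZ_has_vector_derivative)
      then show "\<exists>d\<in>scale_fun c ` schwartz_RZ.
          \<forall>x k. ((\<lambda>x. \<eta> (x, k)) has_vector_derivative d (x, k)) (at x)"
        using \<eta> schwartz_RZ_dx by blast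
    qed (use f in blast)
  qed
qed

section \<open>Twisted actions\<close>


definition twisted_term ::
  "real \<Rightarrow> real \<Rightarrow> real \<Rightarrow> real \<Rightarrow> int \<Rightarrow> (real \<times> int \<Rightarrow> complex) \<Rightarrow> (real \<times> int \<Rightarrow> complex) \<Rightarrow>
   real \<Rightarrow> int \<Rightarrow> int \<Rightarrow> complex" where
  "twisted_term \<alpha> \<beta> \<gamma> \<epsilon> r a \<xi> x k n =
     a (\<alpha> * x + \<beta> * of_int k + \<gamma> * of_int n, n) * \<xi> (x - of_int n * \<epsilon>, k - n * r)"

definition twisted_act ::
  "real \<Rightarrow> real \<Rightarrow> real \<Rightarrow> real \<Rightarrow> int \<Rightarrow> (real \<times> int \<Rightarrow> complex) \<Rightarrow> (real \<times> int \<Rightarrow> complex) \<Rightarrow>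
   real \<times> int \<Rightarrow> complex" where
  "twisted_act \<alpha> \<beta> \<gamma> \<epsilon> r a \<xi> = (\<lambda>(x, k). \<Sum>\<^sub>\<infinity>n. twisted_term \<alpha> \<beta> \<gamma> \<epsilon> r a \<xi> x k n)"

text \<open>Moves a weight from a point to its shift by \<open>n\<close> steps of size
  \<open>s\<close>, at the price of one factor \<open>1 + \<bar>n\<bar>\<close>.\<close>

lemma one_plus_abs_shift_le:
  fixes y s n :: real
  shows "1 + \<bar>y + n * s\<bar> \<le> (1 + \<bar>s\<bar>) * (1 + \<bar>n\<bar>) * (1 + \<bar>y\<bar>)"
proof -
  have "1 + \<bar>y + n * s\<bar> \<le> 1 + \<bar>y\<bar> + \<bar>n\<bar> * \<bar>s\<bar>"
    by (metis abs_mult abs_triangle_ineq add.assoc add_left_mono)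
  also have "\<dots> \<le> (1 + \<bar>s\<bar>) * (1 + \<bar>n\<bar>) * (1 + \<bar>y\<bar>)"
    by (simp add: algebra_simps)
  finally show ?thesis .
qed

text \<open>The weights at \<open>(x, k)\<close> are transferred to the shifted point, where \<xi>
  absorbs them. The powers of \<open>1 + \<bar>n\<bar>\<close> that this costs are absorbed by the
  coefficients \<open>a\<close>, together with the summable factor.\<close>

lemma twisted_term_bound:
  assumes "decaying a" "decaying \<xi>"
  obtains C where "C \<ge> 0" "\<And>x k n. (1 + \<bar>x\<bar>) ^ p * (1 + \<bar>real_of_int k\<bar>) ^ q *
      norm (twisted_term \<alpha> \<beta> \<gamma> \<epsilon> r a \<xi> x k n) \<le> C * weight n"
proof -
  \<comment> \<open>The exponent \<open>p + q\<close> is the cost of the two shifts: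
    \<open>p\<close> for the real variable and \<open>q\<close> for the discrete one.\<close>
  obtain A where A: "A \<ge> 0" "\<And>x n. (1 + \<bar>x\<bar>) ^ 0 * (1 + \<bar>real_of_int n\<bar>) ^ (p + q) * norm (a (x, n)) \<le> A * weight n"
    using decaying_weight[OF assms(1)] by metis
  obtain B where B: "\<And>x n. (1 + \<bar>x\<bar>) ^ p * (1 + \<bar>real_of_int n\<bar>) ^ q * norm (\<xi> (x, n)) \<le> B"
    using assms(2) unfolding decaying_def by metis
  have "0 \<le> (1 + \<bar>0\<bar>) ^ p * (1 + \<bar>real_of_int 0\<bar>) ^ q * norm (\<xi> (0, 0))" by simp
  also have "\<dots> \<le> B" by (rule B)
  finally have B0: "B \<ge> 0" .
  \<comment> \<open>The step sizes \<epsilon> and \<open>r\<close> enter the shift inequalities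
    through these constants.\<close>
  define K where "K = (1 + \<bar>\<epsilon>\<bar>) ^ p * (1 + \<bar>real_of_int r\<bar>) ^ q"
  have K0: "K \<ge> 0" by (simp add: K_def)
  show thesis
  proof
    show "K * A * B \<ge> 0" using A(1) B0 K0 by simp
    fix x k n
    define y where "y = x - of_int n * \<epsilon>"
    define l where "l = k - n * r"
    define v where "v = \<alpha> * x + \<beta> * of_int k + \<gamma> * of_int n"
    have x: "(1 + \<bar>x\<bar>) ^ p \<le> ((1 + \<bar>\<epsilon>\<bar>) * (1 + \<bar>of_int n\<bar>) * (1 + \<bar>y\<bar>)) ^ p"
      using one_plus_abs_shift_le[of y "of_int n" \<epsilon>] by (intro power_mono) (auto simp: y_def)
    have k: "(1 + \<bar>real_of_int k\<bar>) ^ q \<le>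
        ((1 + \<bar>of_int r\<bar>) * (1 + \<bar>of_int n\<bar>) * (1 + \<bar>of_int l\<bar>)) ^ q"
      using one_plus_abs_shift_le[of "of_int l" "of_int n" "of_int r"]
      by (intro power_mono) (auto simp: l_def)
    have "(1 + \<bar>x\<bar>) ^ p * (1 + \<bar>real_of_int k\<bar>) ^ q * norm (twisted_term \<alpha> \<beta> \<gamma> \<epsilon> r a \<xi> x k n) \<le>
        ((1 + \<bar>\<epsilon>\<bar>) * (1 + \<bar>of_int n\<bar>) * (1 + \<bar>y\<bar>)) ^ p *
        ((1 + \<bar>of_int r\<bar>) * (1 + \<bar>of_int n\<bar>) * (1 + \<bar>of_int l\<bar>)) ^ q *
        norm (a (v, n) * \<xi> (y, l))"
      unfolding twisted_term_def v_def[symmetric] y_def[symmetric] l_def[symmetric]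
      by (intro mult_right_mono mult_mono x k) auto
    also have "\<dots> = K * (((1 + \<bar>v\<bar>) ^ 0 * (1 + \<bar>real_of_int n\<bar>) ^ (p + q) * norm (a (v, n))) *
        ((1 + \<bar>y\<bar>) ^ p * (1 + \<bar>real_of_int l\<bar>) ^ q * norm (\<xi> (y, l))))"
      by (simp add: K_def power_mult_distrib power_add norm_mult mult_ac)
    also have "\<dots> \<le> K * ((A * weight n) * B)"
      using A B0 K0 weight_pos[of n] by (intro mult_left_mono mult_mono A B) auto
    finally show "(1 + \<bar>x\<bar>) ^ p * (1 + \<bar>real_of_int k\<bar>) ^ q *
      norm (twisted_term \<alpha> \<beta> \<gamma> \<epsilon> r a \<xi> x k n) \<le> K * A * B * weight n"
      by (simp add: mult_ac)
  qed
qed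

lemma summable_on_weight_bound:
  fixes f :: "int \<Rightarrow> 'a::banach"
  assumes "\<And>n. norm (f n) \<le> C * weight n"
  shows "(\<lambda>n. norm (f n)) summable_on UNIV" "f summable_on UNIV"
    "norm (\<Sum>\<^sub>\<infinity>n. f n) \<le> C * (\<Sum>\<^sub>\<infinity>n. weight n)"
proof -
  have s: "(\<lambda>n. C * weight n) summable_on UNIV"
    by (intro summable_on_cmult_right summable_weight)
  show *: "(\<lambda>n. norm (f n)) summable_on UNIV"
    by (rule Infinite_Sum.abs_summable_on_comparison_test'[OF s]) (use assms in auto)
  then show "f summable_on UNIV" by (rule abs_summable_summable)
  have "norm (\<Sum>\<^sub>\<infinity>n. f n) \<le> (\<Sum>\<^sub>\<infinity>n. norm (f n))" by (rule norm_infsum_bound[OF *])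
  also have "\<dots> \<le> (\<Sum>\<^sub>\<infinity>n. C * weight n)" by (rule infsum_mono[OF * s]) (use assms in auto)
  also have "\<dots> = C * (\<Sum>\<^sub>\<infinity>n. weight n)" by (rule infsum_cmult_right')
  finally show "norm (\<Sum>\<^sub>\<infinity>n. f n) \<le> C * (\<Sum>\<^sub>\<infinity>n. weight n)" .
qed

lemma twisted_term_weight_bound:
  assumes "decaying a" "decaying \<xi>"
  obtains C where "\<And>x k n. norm (twisted_term \<alpha> \<beta> \<gamma> \<epsilon> r a \<xi> x k n) \<le> C * weight n"
proof -
  obtain C where "\<And>x k n. (1 + \<bar>x\<bar>) ^ 0 * (1 + \<bar>real_of_int k\<bar>) ^ 0 *
      norm (twisted_term \<alpha> \<beta> \<gamma> \<epsilon> r a \<xi> x k n) \<le> C * weight n"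
    using twisted_term_bound[OF assms] by metis
  then show thesis by (intro that[of C]) simp
qed

lemma twisted_term_summable:
  assumes "decaying a" "decaying \<xi>"
  shows "twisted_term \<alpha> \<beta> \<gamma> \<epsilon> r a \<xi> x k summable_on UNIV"
  using twisted_term_weight_bound[OF assms] summable_on_weight_bound(2) by metis

lemma decaying_twisted_act:
  assumes "decaying a" "decaying \<xi>"
  shows "decaying (twisted_act \<alpha> \<beta> \<gamma> \<epsilon> r a \<xi>)"
  unfolding decaying_def
proof (intro allI)
  fix p q
  obtain C where C: "\<And>x k n. (1 + \<bar>x\<bar>) ^ p * (1 + \<bar>real_of_int k\<bar>) ^ q *
      norm (twisted_term \<alpha> \<beta> \<gamma> \<epsilon> r a \<xi> x k n) \<le> C * weight n"
    using twisted_term_bound[OF assms] by metis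
  have "(1 + \<bar>x\<bar>) ^ p * (1 + \<bar>real_of_int k\<bar>) ^ q * norm (twisted_act \<alpha> \<beta> \<gamma> \<epsilon> r a \<xi> (x, k))
      \<le> C * (\<Sum>\<^sub>\<infinity>n. weight n)" for x k
  proof -
    let ?c = "(1 + \<bar>x\<bar>) ^ p * (1 + \<bar>real_of_int k\<bar>) ^ q"
    \<comment> \<open>For fixed \<open>(x, k)\<close> the weights are a scalar that can be moved
      under the sum, where the termwise bound holds.\<close>
    have "norm (\<Sum>\<^sub>\<infinity>n. of_real ?c * twisted_term \<alpha> \<beta> \<gamma> \<epsilon> r a \<xi> x k n) \<le> C * (\<Sum>\<^sub>\<infinity>n. weight n)"
    proof (rule summable_on_weight_bound(3))
      fix n
      have "norm (of_real ?c * twisted_term \<alpha> \<beta> \<gamma> \<epsilon> r a \<xi> x k n) =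
          ?c * norm (twisted_term \<alpha> \<beta> \<gamma> \<epsilon> r a \<xi> x k n)"
        unfolding norm_mult norm_of_real by simp
      with C show "norm (of_real ?c * twisted_term \<alpha> \<beta> \<gamma> \<epsilon> r a \<xi> x k n) \<le> C * weight n"
        by simp
    qed
    then show ?thesis
      unfolding infsum_cmult_right' norm_mult norm_of_real twisted_act_def by simp
  qed
  then show "\<exists>C. \<forall>x k. (1 + \<bar>x\<bar>) ^ p * (1 + \<bar>real_of_int k\<bar>) ^ q *
      norm (twisted_act \<alpha> \<beta> \<gamma> \<epsilon> r a \<xi> (x, k)) \<le> C" by blast
qed

lemma twisted_act_bilinear:
  assumes "decaying a" "decaying b" "decaying \<xi>" "decaying \<eta>"
  shows "twisted_act \<alpha> \<beta> \<gamma> \<epsilon> r (a + b) \<xi> = twisted_act \<alpha> \<beta> \<gamma> \<epsilon> r a \<xi> + twisted_act \<alpha> \<beta> \<gamma> \<epsilon> r b \<xi>"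
    and "twisted_act \<alpha> \<beta> \<gamma> \<epsilon> r a (\<xi> + \<eta>) = twisted_act \<alpha> \<beta> \<gamma> \<epsilon> r a \<xi> + twisted_act \<alpha> \<beta> \<gamma> \<epsilon> r a \<eta>"
    and "twisted_act \<alpha> \<beta> \<gamma> \<epsilon> r (scale_fun c a) \<xi> = scale_fun c (twisted_act \<alpha> \<beta> \<gamma> \<epsilon> r a \<xi>)"
    and "twisted_act \<alpha> \<beta> \<gamma> \<epsilon> r a (scale_fun c \<xi>) = scale_fun c (twisted_act \<alpha> \<beta> \<gamma> \<epsilon> r a \<xi>)"
proof -
  note s = twisted_term_summable[OF assms(1,3)] twisted_term_summable[OF assms(2,3)]
    twisted_term_summable[OF assms(1,4)]
  have "twisted_term \<alpha> \<beta> \<gamma> \<epsilon> r (a + b) \<xi> x k =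
      (\<lambda>n. twisted_term \<alpha> \<beta> \<gamma> \<epsilon> r a \<xi> x k n + twisted_term \<alpha> \<beta> \<gamma> \<epsilon> r b \<xi> x k n)" for x k
    by (auto simp: twisted_term_def algebra_simps)
  then show "twisted_act \<alpha> \<beta> \<gamma> \<epsilon> r (a + b) \<xi> = twisted_act \<alpha> \<beta> \<gamma> \<epsilon> r a \<xi> + twisted_act \<alpha> \<beta> \<gamma> \<epsilon> r b \<xi>"
    by (auto simp: twisted_act_def fun_eq_iff infsum_add s)
  have "twisted_term \<alpha> \<beta> \<gamma> \<epsilon> r a (\<xi> + \<eta>) x k =
      (\<lambda>n. twisted_term \<alpha> \<beta> \<gamma> \<epsilon> r a \<xi> x k n + twisted_term \<alpha> \<beta> \<gamma> \<epsilon> r a \<eta> x k n)" for x k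
    by (auto simp: twisted_term_def algebra_simps)
  then show "twisted_act \<alpha> \<beta> \<gamma> \<epsilon> r a (\<xi> + \<eta>) = twisted_act \<alpha> \<beta> \<gamma> \<epsilon> r a \<xi> + twisted_act \<alpha> \<beta> \<gamma> \<epsilon> r a \<eta>"
    by (auto simp: twisted_act_def fun_eq_iff infsum_add s)
  have "twisted_term \<alpha> \<beta> \<gamma> \<epsilon> r (scale_fun c a) \<xi> x k = (\<lambda>n. c * twisted_term \<alpha> \<beta> \<gamma> \<epsilon> r a \<xi> x k n)"
    "twisted_term \<alpha> \<beta> \<gamma> \<epsilon> r a (scale_fun c \<xi>) x k = (\<lambda>n. c * twisted_term \<alpha> \<beta> \<gamma> \<epsilon> r a \<xi> x k n)" for x k
    by (auto simp: twisted_term_def scale_fun_def)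
  then show "twisted_act \<alpha> \<beta> \<gamma> \<epsilon> r (scale_fun c a) \<xi> = scale_fun c (twisted_act \<alpha> \<beta> \<gamma> \<epsilon> r a \<xi>)"
    "twisted_act \<alpha> \<beta> \<gamma> \<epsilon> r a (scale_fun c \<xi>) = scale_fun c (twisted_act \<alpha> \<beta> \<gamma> \<epsilon> r a \<xi>)"
    by (auto simp: twisted_act_def scale_fun_def fun_eq_iff infsum_cmult_right')
qed

text \<open>The product rule, term by term. The factor \<alpha> comes from the chain rule in the
  argument of \<open>a\<close>, while the argument of \<xi> moves at speed 1; both resulting series
  have a majorant by the bound on twisted terms.\<close>

lemma twisted_act_has_vector_derivative:
  assumes a: "a \<in> schwartz_RZ" and \<xi>: "\<xi> \<in> schwartz_RZ"
  shows "((\<lambda>x. twisted_act \<alpha> \<beta> \<gamma> \<epsilon> r a \<xi> (x, k)) has_vector_derivative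
    (twisted_act \<alpha> \<beta> \<gamma> \<epsilon> r (scale_fun (of_real \<alpha>) (dx a)) \<xi> + twisted_act \<alpha> \<beta> \<gamma> \<epsilon> r a (dx \<xi>)) (x, k)) (at x)"
proof -
  let ?a' = "scale_fun (of_real \<alpha>) (dx a)"
  note d = schwartz_RZ_decaying
  have a': "decaying ?a'" by (intro decaying_scale d schwartz_RZ_dx a)
  obtain C where C: "\<And>x k n. norm (twisted_term \<alpha> \<beta> \<gamma> \<epsilon> r ?a' \<xi> x k n) \<le> C * weight n"
    using twisted_term_weight_bound[OF a' d[OF \<xi>]] by metis
  obtain D where D: "\<And>x k n. norm (twisted_term \<alpha> \<beta> \<gamma> \<epsilon> r a (dx \<xi>) x k n) \<le> D * weight n"
    using twisted_term_weight_bound[OF d[OF a] d[OF schwartz_RZ_dx[OF \<xi>]]] by metis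
  have "((\<lambda>x. \<Sum>\<^sub>\<infinity>n. twisted_term \<alpha> \<beta> \<gamma> \<epsilon> r a \<xi> x k n) has_vector_derivative
     (\<Sum>\<^sub>\<infinity>n. twisted_term \<alpha> \<beta> \<gamma> \<epsilon> r ?a' \<xi> x k n + twisted_term \<alpha> \<beta> \<gamma> \<epsilon> r a (dx \<xi>) x k n)) (at x)"
  proof (rule has_vector_derivative_infsum)
    fix n x
    have 1: "((\<lambda>x. a (\<alpha> * x + \<beta> * of_int k + \<gamma> * of_int n, n)) has_vector_derivative
        \<alpha> *\<^sub>R dx a (\<alpha> * x + \<beta> * of_int k + \<gamma> * of_int n, n)) (at x)"
      by (rule vector_diff_chain_at[unfolded o_def, where
            f = "\<lambda>x. \<alpha> * x + \<beta> * of_int k + \<gamma> * of_int n" and g = "\<lambda>x. a (x, n)" and f' = \<alpha>])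
        (auto intro!: derivative_eq_intros schwartz_RZ_has_vector_derivative[OF a]
          simp: has_real_derivative_iff_has_vector_derivative[symmetric])
    have 2: "((\<lambda>x. \<xi> (x - of_int n * \<epsilon>, k - n * r)) has_vector_derivative
        1 *\<^sub>R dx \<xi> (x - of_int n * \<epsilon>, k - n * r)) (at x)"
      by (rule vector_diff_chain_at[unfolded o_def, where
            f = "\<lambda>x. x - of_int n * \<epsilon>" and g = "\<lambda>x. \<xi> (x, k - n * r)" and f' = 1])
        (auto intro!: derivative_eq_intros schwartz_RZ_has_vector_derivative[OF \<xi>]
          simp: has_real_derivative_iff_has_vector_derivative[symmetric])
    show "((\<lambda>x. twisted_term \<alpha> \<beta> \<gamma> \<epsilon> r a \<xi> x k n) has_vector_derivative
        twisted_term \<alpha> \<beta> \<gamma> \<epsilon> r ?a' \<xi> x k n + twisted_term \<alpha> \<beta> \<gamma> \<epsilon> r a (dx \<xi>) x k n) (at x)"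
      using has_vector_derivative_mult[OF 1 2]
      by (simp add: twisted_term_def scale_fun_def scaleR_conv_of_real mult_ac add.commute)
    show "norm (twisted_term \<alpha> \<beta> \<gamma> \<epsilon> r ?a' \<xi> x k n + twisted_term \<alpha> \<beta> \<gamma> \<epsilon> r a (dx \<xi>) x k n)
        \<le> (C + D) * weight n"
      using norm_triangle_mono[OF C[of x k n] D[of x k n]] by (simp add: algebra_simps)
  qed (auto intro: summable_on_cmult_right summable_weight twisted_term_summable d a \<xi>)
  also have "(\<Sum>\<^sub>\<infinity>n. twisted_term \<alpha> \<beta> \<gamma> \<epsilon> r ?a' \<xi> x k n + twisted_term \<alpha> \<beta> \<gamma> \<epsilon> r a (dx \<xi>) x k n) =
      (twisted_act \<alpha> \<beta> \<gamma> \<epsilon> r ?a' \<xi> + twisted_act \<alpha> \<beta> \<gamma> \<epsilon> r a (dx \<xi>)) (x, k)"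
    by (simp add: twisted_act_def infsum_add twisted_term_summable a' d a \<xi> schwartz_RZ_dx)
  finally show ?thesis by (simp add: twisted_act_def)
qed

text \<open>Differentiating \<open>twisted_act\<close> yields sums of two terms of the same kind, so the
  coinduction runs over the span of all of them.\<close>

lemma twisted_act_schwartz_RZ:
  assumes "a \<in> schwartz_RZ" "\<xi> \<in> schwartz_RZ"
  shows "twisted_act \<alpha> \<beta> \<gamma> \<epsilon> r a \<xi> \<in> schwartz_RZ"
proof -
  interpret vector_space scale_fun by (rule vector_space_scale_fun)
  let ?G = "{twisted_act \<alpha> \<beta> \<gamma> \<epsilon> r a \<xi> |a \<xi>. a \<in> schwartz_RZ \<and> \<xi> \<in> schwartz_RZ}"
  let ?Q = "{\<eta>. decaying \<eta> \<and>
    (\<exists>d\<in>span ?G. \<forall>x k. ((\<lambda>x. \<eta> (x, k)) has_vector_derivative d (x, k)) (at x))}"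
  \<comment> \<open>It suffices that \<open>?Q\<close> is a subspace containing the generators; the
    whole span then decays and is closed under differentiation.\<close>
  have "span ?G \<subseteq> ?Q"
  proof (rule span_minimal)
    show "?G \<subseteq> ?Q"
    proof
      fix \<eta> assume "\<eta> \<in> ?G"
      then obtain a \<xi> where \<eta>: "\<eta> = twisted_act \<alpha> \<beta> \<gamma> \<epsilon> r a \<xi>" "a \<in> schwartz_RZ" "\<xi> \<in> schwartz_RZ" by blast
      let ?d = "twisted_act \<alpha> \<beta> \<gamma> \<epsilon> r (scale_fun (of_real \<alpha>) (dx a)) \<xi> + twisted_act \<alpha> \<beta> \<gamma> \<epsilon> r a (dx \<xi>)"
      have "?d \<in> span ?G"
        using \<eta> by (blast intro: span_add span_base schwartz_RZ_dx subspace_scale[OF subspace_schwartz_RZ])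
      moreover have "\<forall>x k. ((\<lambda>x. \<eta> (x, k)) has_vector_derivative ?d (x, k)) (at x)"
        using \<eta> twisted_act_has_vector_derivative by blast
      moreover have "decaying \<eta>" using \<eta> by (simp add: decaying_twisted_act schwartz_RZ_decaying)
      ultimately show "\<eta> \<in> ?Q" by blast
    qed
    show "subspace ?Q"
    proof (rule subspaceI)
      show "0 \<in> ?Q" using span_zero by (auto simp: decaying_0 intro!: bexI[of _ 0])
    next
      fix f g assume "f \<in> ?Q" "g \<in> ?Q"
      then obtain d e where *: "decaying f" "decaying g" "d \<in> span ?G" "e \<in> span ?G"
        "\<And>x k. ((\<lambda>x. f (x, k)) has_vector_derivative d (x, k)) (at x)"
        "\<And>x k. ((\<lambda>x. g (x, k)) has_vector_derivative e (x, k)) (at x)" by blast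
      then have "\<forall>x k. ((\<lambda>x. (f + g) (x, k)) has_vector_derivative (d + e) (x, k)) (at x)"
        by (auto intro: has_vector_derivative_add)
      then show "f + g \<in> ?Q" using * decaying_add span_add by blast
    next
      fix c f assume "f \<in> ?Q"
      then obtain d where *: "decaying f" "d \<in> span ?G"
        "\<And>x k. ((\<lambda>x. f (x, k)) has_vector_derivative d (x, k)) (at x)" by blast
      then have "\<forall>x k. ((\<lambda>x. scale_fun c f (x, k)) has_vector_derivative scale_fun c d (x, k)) (at x)"
        unfolding scale_fun_def by (auto intro: has_vector_derivative_mult_right)
      then show "scale_fun c f \<in> ?Q" using * decaying_scale span_scale by blast
    qed
  qed
  moreover have "twisted_act \<alpha> \<beta> \<gamma> \<epsilon> r a \<xi> \<in> span ?G" using assms by (blast intro: span_base)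
  ultimately show ?thesis
    by (intro schwartz_RZ_coinduct[of _ "span ?G"]) auto
qed


section \<open>Double sums and the composition of two twisted actions\<close>

lemma summable_on_weight_pair_bound:
  fixes F :: "int \<times> int \<Rightarrow> 'a::banach"
  assumes "\<And>i j. norm (F (i, j)) \<le> C * (weight i * weight j)"
  shows "F summable_on UNIV"
proof -
  have "(\<lambda>(i, j). weight i * weight j) summable_on (UNIV \<times> UNIV)"
  proof (rule summable_on_SigmaI)
    show "((\<lambda>j. (case (i, j) of (i, j) \<Rightarrow> weight i * weight j)) has_sum
        weight i * (\<Sum>\<^sub>\<infinity>j. weight j)) UNIV" for i
      using summable_weight by (simp add: has_sum_cmult_right)
    show "(\<lambda>i. weight i * (\<Sum>\<^sub>\<infinity>j. weight j)) summable_on UNIV"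
      by (intro summable_on_cmult_left summable_weight)
  qed (auto simp: weight_pos less_imp_le)
  then have "(\<lambda>z. C * (case z of (i, j) \<Rightarrow> weight i * weight j)) summable_on UNIV"
    by (intro summable_on_cmult_right) simp
  then have "(\<lambda>z. norm (F z)) summable_on UNIV"
    by (rule Infinite_Sum.abs_summable_on_comparison_test') (use assms in auto)
  then show ?thesis by (rule abs_summable_summable)
qed

lemma infsum_pair:
  fixes F :: "int \<times> int \<Rightarrow> 'a::banach"
  assumes "F summable_on UNIV"
  shows "(\<Sum>\<^sub>\<infinity>i. \<Sum>\<^sub>\<infinity>j. F (i, j)) = (\<Sum>\<^sub>\<infinity>z. F z)"
  using infsum_Sigma_banach[of F UNIV "\<lambda>_. UNIV"] assms by simp

text \<open>The outer coefficients contribute \<open>weight i\<close>, and the inner terms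
  contribute \<open>weight j\<close> uniformly in the shifted base point, so the double series
  converges absolutely and the iterated sum is a sum over pairs.\<close>

lemma twisted_act_twisted_act:
  assumes a: "decaying a" and b: "decaying b" and \<xi>: "decaying \<xi>"
  shows "twisted_act \<alpha> \<beta> \<gamma> \<epsilon> r a (twisted_act \<alpha>' \<beta>' \<gamma>' \<epsilon>' r' b \<xi>) (x, k) =
    (\<Sum>\<^sub>\<infinity>(i, j). a (\<alpha> * x + \<beta> * of_int k + \<gamma> * of_int i, i) *
       twisted_term \<alpha>' \<beta>' \<gamma>' \<epsilon>' r' b \<xi> (x - of_int i * \<epsilon>) (k - i * r) j)" (is "_ = (\<Sum>\<^sub>\<infinity>z. ?F z)")
proof -
  obtain A where A: "A \<ge> 0" "\<And>x n. norm (a (x, n)) \<le> A * weight n"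
    using decaying_weight_bounded[OF a] by metis
  obtain C where C: "\<And>x k n. norm (twisted_term \<alpha>' \<beta>' \<gamma>' \<epsilon>' r' b \<xi> x k n) \<le> C * weight n"
    using twisted_term_weight_bound[OF b \<xi>] by metis
  have "?F summable_on UNIV"
  proof (rule summable_on_weight_pair_bound)
    fix i j
    have "norm (?F (i, j)) \<le> (A * weight i) * (C * weight j)"
      unfolding prod.case norm_mult using A weight_pos[of i] by (intro mult_mono A C) auto
    then show "norm (?F (i, j)) \<le> (A * C) * (weight i * weight j)" by (simp add: mult_ac)
  qed
  then have "(\<Sum>\<^sub>\<infinity>i. \<Sum>\<^sub>\<infinity>j. ?F (i, j)) = (\<Sum>\<^sub>\<infinity>z. ?F z)" by (rule infsum_pair)
  then show ?thesis by (simp add: twisted_act_def infsum_cmult_right' twisted_term_def[of \<alpha>])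
qed

text \<open>The product of the algebra on coefficient sequences. The step is \<open>- h\<close>
  because the second factor is read at \<open>u + k * h\<close>.\<close>

abbreviation conv ::
  "real \<Rightarrow> (real \<times> int \<Rightarrow> complex) \<Rightarrow> (real \<times> int \<Rightarrow> complex) \<Rightarrow> real \<times> int \<Rightarrow> complex" where
  "conv h \<equiv> twisted_act 1 0 0 (- h) 1"

text \<open>The sum over the total frequency and the inner sum of the product combine into one sum
  over the pair of frequencies of \<open>a\<close> and \<open>b\<close>. Absolute convergence
  follows from the decay of \<open>a\<close> and \<open>b\<close>, with \<xi> bounded.\<close>

lemma twisted_act_conv:
  fixes \<alpha> \<beta> \<gamma> :: real
  assumes a: "decaying a" and b: "decaying b" and \<xi>: "decaying \<xi>"
  defines "v \<equiv> \<lambda>x k n. \<alpha> * x + \<beta> * of_int k + \<gamma> * of_int (n::int)"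
  shows "twisted_act \<alpha> \<beta> \<gamma> \<epsilon> r (conv h a b) \<xi> (x, k) =
    (\<Sum>\<^sub>\<infinity>(i, j). a (v x k (i + j), i) * b (v x k (i + j) + of_int i * h, j) *
       \<xi> (x - of_int (i + j) * \<epsilon>, k - (i + j) * r))" (is "_ = (\<Sum>\<^sub>\<infinity>z. ?F z)")
proof -
  obtain A where A: "A \<ge> 0" "\<And>x n. norm (a (x, n)) \<le> A * weight n"
    using decaying_weight_bounded[OF a] by metis
  obtain B where B: "B \<ge> 0" "\<And>x n. norm (b (x, n)) \<le> B * weight n"
    using decaying_weight_bounded[OF b] by metis
  obtain C where C: "C \<ge> 0" "\<And>x n. norm (\<xi> (x, n)) \<le> C"
    using decaying_bounded[OF \<xi>] by metis
  have F: "?F summable_on UNIV"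
  proof (rule summable_on_weight_pair_bound)
    fix i j
    have "norm (?F (i, j)) \<le> (A * weight i) * (B * weight j) * C"
      unfolding prod.case norm_mult using A(1) B(1) weight_pos[of i] weight_pos[of j]
      by (intro mult_mono A B C) auto
    then show "norm (?F (i, j)) \<le> (A * B * C) * (weight i * weight j)" by (simp add: mult_ac)
  qed
  \<comment> \<open>Change of indices from total and first frequency to first and second
    frequency.\<close>
  define s where "s = (\<lambda>(n :: int, i). (i, n - i))"
  have s: "bij_betw s UNIV UNIV"
    by (rule bij_betwI[of _ _ _ "\<lambda>(i, j). (i + j, i)"]) (auto simp: s_def)
  have "(\<lambda>z. ?F (s z)) summable_on UNIV"
    using F summable_on_reindex_bij_betw[OF s] by blast
  then have "(\<Sum>\<^sub>\<infinity>n. \<Sum>\<^sub>\<infinity>i. ?F (s (n, i))) = (\<Sum>\<^sub>\<infinity>z. ?F (s z))" by (rule infsum_pair)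
  also have "\<dots> = (\<Sum>\<^sub>\<infinity>z. ?F z)" by (rule infsum_reindex_bij_betw[OF s])
  also have "(\<Sum>\<^sub>\<infinity>n. \<Sum>\<^sub>\<infinity>i. ?F (s (n, i))) = twisted_act \<alpha> \<beta> \<gamma> \<epsilon> r (conv h a b) \<xi> (x, k)"
    by (simp add: twisted_act_def twisted_term_def s_def v_def infsum_cmult_left')
  finally show ?thesis by simp
qed

lemma infsum_pair_swap:
  fixes F :: "'a \<Rightarrow> 'b \<Rightarrow> 'c::{topological_comm_monoid_add, t2_space}"
  shows "(\<Sum>\<^sub>\<infinity>(i, j). F i j) = (\<Sum>\<^sub>\<infinity>(j, i). F i j)"
proof -
  have "bij_betw prod.swap (UNIV :: ('b \<times> 'a) set) UNIV" by simp
  from infsum_reindex_bij_betw[OF this, of "\<lambda>(i, j). F i j"] show ?thesis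
    by (simp add: case_prod_unfold)
qed

text \<open>The point where the numerical hypotheses of the theorem take effect. The value
  \<open>c\<close> is \<open>- h\<close> for the left action, \<open>h\<close> for the right action
  and 0 when one action meets the coefficients of the other.\<close>

lemma twisted_argument_shift:
  fixes \<alpha> \<beta> \<epsilon> x :: real and r k i :: int
  assumes "\<alpha> * \<epsilon> + \<beta> * of_int r = c"
  shows "\<alpha> * (x - of_int i * \<epsilon>) + \<beta> * of_int (k - i * r) = \<alpha> * x + \<beta> * of_int k - of_int i * c"
  by (simp add: assms[symmetric] algebra_simps)

text \<open>The shift made by \<open>a\<close> at frequency \<open>i\<close> moves the argument of
  \<open>b\<close> by \<open>i * h\<close>, exactly as in the product, and the shifts of \<xi> add
  up to \<open>i + j\<close>. The two double sums then agree term by term.\<close>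

lemma twisted_act_conv_left:
  assumes "decaying a" "decaying b" "decaying \<xi>"
    and h: "\<alpha> * \<epsilon> + \<beta> * of_int r = - h"
  shows "twisted_act \<alpha> \<beta> 0 \<epsilon> r (conv h a b) \<xi> = twisted_act \<alpha> \<beta> 0 \<epsilon> r a (twisted_act \<alpha> \<beta> 0 \<epsilon> r b \<xi>)"
proof (intro ext, clarify)
  fix x k
  show "twisted_act \<alpha> \<beta> 0 \<epsilon> r (conv h a b) \<xi> (x, k) =
      twisted_act \<alpha> \<beta> 0 \<epsilon> r a (twisted_act \<alpha> \<beta> 0 \<epsilon> r b \<xi>) (x, k)"
    unfolding twisted_act_twisted_act[OF assms(1-3)] twisted_act_conv[OF assms(1-3)] twisted_term_def
      twisted_argument_shift[OF h]
    by (intro infsum_cong) (auto simp: algebra_simps)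
qed

text \<open>With \<gamma> equal to \<open>- h\<close>, the product puts \<open>a\<close> at the base
  argument minus \<open>(i + j) * h\<close>, and \<open>b\<close>, read \<open>i * h\<close>
  further, at the base argument minus \<open>j * h\<close>. Acting by \<open>a\<close> first and
  \<open>b\<close> second gives the same terms with the frequencies listed in the opposite order,
  hence the swap.\<close>

lemma twisted_act_conv_right:
  assumes "decaying a" "decaying b" "decaying \<xi>"
    and h: "\<alpha> * \<epsilon> + \<beta> * of_int r = h"
  shows "twisted_act \<alpha> \<beta> (- h) \<epsilon> r (conv h a b) \<xi> = twisted_act \<alpha> \<beta> (- h) \<epsilon> r b (twisted_act \<alpha> \<beta> (- h) \<epsilon> r a \<xi>)"
proof (intro ext, clarify)
  fix x k
  show "twisted_act \<alpha> \<beta> (- h) \<epsilon> r (conv h a b) \<xi> (x, k) =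
      twisted_act \<alpha> \<beta> (- h) \<epsilon> r b (twisted_act \<alpha> \<beta> (- h) \<epsilon> r a \<xi>) (x, k)"
    unfolding twisted_act_twisted_act[OF assms(2,1,3)] twisted_act_conv[OF assms(1-3)] twisted_term_def
      twisted_argument_shift[OF h]
    by (subst infsum_pair_swap, intro infsum_cong) (auto simp: algebra_simps)
qed

text \<open>By the two conditions, the shift made by either action leaves the coefficient argument
  of the other unchanged. The shifts of \<xi> commute, so only the order of the indices
  differs.\<close>

lemma twisted_act_commute:
  assumes a: "decaying a" and b: "decaying b" and \<xi>: "decaying \<xi>"
    and 1: "\<alpha> * \<epsilon>' + \<beta> * of_int r' = 0" and 2: "\<alpha>' * \<epsilon> + \<beta>' * of_int r = 0"
  shows "twisted_act \<alpha>' \<beta>' \<gamma>' \<epsilon>' r' b (twisted_act \<alpha> \<beta> \<gamma> \<epsilon> r a \<xi>) =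
    twisted_act \<alpha> \<beta> \<gamma> \<epsilon> r a (twisted_act \<alpha>' \<beta>' \<gamma>' \<epsilon>' r' b \<xi>)"
proof (intro ext, clarify)
  fix x k
  show "twisted_act \<alpha>' \<beta>' \<gamma>' \<epsilon>' r' b (twisted_act \<alpha> \<beta> \<gamma> \<epsilon> r a \<xi>) (x, k) =
    twisted_act \<alpha> \<beta> \<gamma> \<epsilon> r a (twisted_act \<alpha>' \<beta>' \<gamma>' \<epsilon>' r' b \<xi>) (x, k)"
    unfolding twisted_act_twisted_act[OF b a \<xi>] twisted_act_twisted_act[OF a b \<xi>] twisted_term_def
      twisted_argument_shift[OF 1] twisted_argument_shift[OF 2]
    by (subst infsum_pair_swap, intro infsum_cong) (auto simp: algebra_simps)
qed

section \<open>The space \<open>\<S>(\<real> \<times> S\<^sup>1)\<close>\<close>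


lemma Basis_real_real: "(Basis :: (real \<times> real) set) = {(1, 0), (0, 1)}"
  by (auto simp: Basis_prod_def)

lemma schwartz_RS_periodic: "f \<in> schwartz_RS \<Longrightarrow> f (u, t + 1) = f (u, t)"
  by (simp add: schwartz_RS_def)

lemma schwartz_RS_differentiable: "f \<in> schwartz_RS \<Longrightarrow> f differentiable (at z)"
  by (simp add: schwartz_RS_def smooth_differentiable)

lemma schwartz_RS_bound:
  assumes "f \<in> schwartz_RS"
  obtains C where "\<And>u t. \<bar>u\<bar> ^ p * norm (f (u, t)) \<le> C"
proof -
  have "\<exists>C. \<forall>u t. \<bar>u\<bar> ^ p * norm (iterated_deriv [] f (u, t)) \<le> C"
    using assms unfolding schwartz_RS_def by (simp only: mem_Collect_eq set_simps empty_subsetI)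
  then show thesis using that by auto
qed

lemma schwartz_RS_iterated_deriv:
  assumes f: "f \<in> schwartz_RS" and v: "v \<in> Basis"
  shows "iterated_deriv [v] f \<in> schwartz_RS"
proof -
  have "smooth (iterated_deriv [v] f)"
    using f v by (intro smooth_iterated_deriv) (auto simp: schwartz_RS_def)
  moreover have "\<exists>C. \<forall>u t. \<bar>u\<bar> ^ p * norm (iterated_deriv vs (iterated_deriv [v] f) (u, t)) \<le> C"
    if "set vs \<subseteq> Basis" for p vs
  proof -
    have "set (vs @ [v]) \<subseteq> Basis" using that v by simp
    then show ?thesis using f unfolding schwartz_RS_def iterated_deriv_append[symmetric] by blast
  qed
  \<comment> \<open>Translation by \<open>(0, 1)\<close> fixes \<open>f\<close> and has the identity
    as derivative, so uniqueness of the derivative passes periodicity on to the partial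
    derivatives.\<close>
  moreover have "iterated_deriv [v] f (u, t + 1) = iterated_deriv [v] f (u, t)" for u t
  proof -
    have "(f has_derivative frechet_derivative f (at (u, t + 1))) (at ((u, t) + (0, 1)))"
      using schwartz_RS_differentiable[OF f, of "(u, t + 1)"]
      by (simp add: frechet_derivative_works)
    then have "((\<lambda>z. f (z + (0, 1))) has_derivative frechet_derivative f (at (u, t + 1))) (at (u, t))"
      by (intro has_derivative_compose[where f = "\<lambda>z. z + (0, 1)" and f' = "\<lambda>h. h" and g = f])
        (auto intro!: derivative_eq_intros)
    moreover have "(\<lambda>z. f (z + (0, 1))) = f"
      using schwartz_RS_periodic[OF f] by auto
    ultimately have "frechet_derivative f (at (u, t + 1)) = frechet_derivative f (at (u, t))"
      by (simp add: frechet_derivative_at)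
    then show ?thesis by simp
  qed
  ultimately show ?thesis unfolding schwartz_RS_def by blast
qed

lemma has_derivative_partials:
  fixes f :: "real \<times> real \<Rightarrow> complex"
  assumes "f differentiable (at z)"
  shows "(f has_derivative (\<lambda>h. fst h *\<^sub>R iterated_deriv [(1, 0)] f z
    + snd h *\<^sub>R iterated_deriv [(0, 1)] f z)) (at z)"
proof -
  let ?D = "frechet_derivative f (at z)"
  have D: "(f has_derivative ?D) (at z)" using assms by (simp add: frechet_derivative_works)
  then have "linear ?D" by (rule has_derivative_linear)
  then have "?D h = fst h *\<^sub>R ?D (1, 0) + snd h *\<^sub>R ?D (0, 1)" for h
    by (subst linear_scale[symmetric], assumption)+ (simp flip: linear_add)
  then have "?D = (\<lambda>h. fst h *\<^sub>R ?D (1, 0) + snd h *\<^sub>R ?D (0, 1))" by blast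
  with D show ?thesis by simp
qed

lemma iterated_deriv_partials:
  fixes f :: "real \<times> real \<Rightarrow> complex"
  assumes "\<And>z. (f has_derivative (\<lambda>h. fst h *\<^sub>R d1 z + snd h *\<^sub>R d2 z)) (at z)"
  shows "iterated_deriv [(1, 0)] f = d1" "iterated_deriv [(0, 1)] f = d2"
  by (simp_all add: fun_eq_iff frechet_derivative_at[OF assms, symmetric])

text \<open>The analogue in two variables: all iterated partial derivatives stay in
  \<open>S\<close>. The premise asks for the total derivative and not just for two partial ones,
  since \<open>smooth\<close> demands total differentiability at every order.\<close>

lemma schwartz_RS_coinduct:
  assumes "f \<in> S"
    and per: "\<And>g u t. g \<in> S \<Longrightarrow> g (u, t + 1) = g (u, t)"
    and decay: "\<And>g p. g \<in> S \<Longrightarrow> \<exists>C. \<forall>u t. \<bar>u\<bar> ^ p * norm (g (u, t)) \<le> C"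
    and deriv: "\<And>g. g \<in> S \<Longrightarrow> \<exists>d1\<in>S. \<exists>d2\<in>S. \<forall>z.
      (g has_derivative (\<lambda>h. fst h *\<^sub>R d1 z + snd h *\<^sub>R d2 z)) (at z)"
  shows "f \<in> schwartz_RS"
proof -
  have S: "iterated_deriv vs f \<in> S" if "set vs \<subseteq> Basis" for vs
  proof (rule iterated_deriv_invariant[of "\<lambda>g. g \<in> S", OF _ \<open>f \<in> S\<close> that])
    fix g v assume "g \<in> S" and v: "v \<in> (Basis :: (real \<times> real) set)"
    then obtain d1 d2 where d: "d1 \<in> S" "d2 \<in> S"
      "\<And>z. (g has_derivative (\<lambda>h. fst h *\<^sub>R d1 z + snd h *\<^sub>R d2 z)) (at z)"
      using deriv by blast
    with v iterated_deriv_partials[OF d(3)] show "iterated_deriv [v] g \<in> S"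
      unfolding Basis_real_real by fastforce
  qed
  have "smooth f"
    unfolding smooth_def
  proof (intro allI impI)
    fix vs and z :: "real \<times> real" assume "set vs \<subseteq> (Basis :: (real \<times> real) set)"
    from deriv[OF S[OF this]] show "iterated_deriv vs f differentiable at z"
      unfolding differentiable_def by blast
  qed
  then show ?thesis
    unfolding schwartz_RS_def using per[OF \<open>f \<in> S\<close>] decay[OF S] by blast
qed

lemma subspace_schwartz_RS: "module.subspace scale_fun schwartz_RS"
proof -
  interpret vector_space scale_fun by (rule vector_space_scale_fun)
  let ?u = "\<lambda>f. iterated_deriv [(1, 0) :: real \<times> real] f"
  let ?t = "\<lambda>f. iterated_deriv [(0, 1) :: real \<times> real] f"
  have D: "?u f \<in> schwartz_RS" "?t f \<in> schwartz_RS"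
    "(f has_derivative (\<lambda>h. fst h *\<^sub>R ?u f z + snd h *\<^sub>R ?t f z)) (at z)"
    if "f \<in> schwartz_RS" for f z
    using that schwartz_RS_iterated_deriv has_derivative_partials schwartz_RS_differentiable
    unfolding Basis_real_real by blast+
  show ?thesis
  proof (rule subspaceI)
    show "0 \<in> schwartz_RS"
      by (rule schwartz_RS_coinduct[of _ "{0}"]) (auto simp: zero_fun_def)
  next
    fix f g assume fg: "f \<in> schwartz_RS" "g \<in> schwartz_RS"
    let ?S = "{f + g |f g. f \<in> schwartz_RS \<and> g \<in> schwartz_RS}"
    show "f + g \<in> schwartz_RS"
    proof (rule schwartz_RS_coinduct[of _ ?S])
      show "f + g \<in> ?S" using fg by blast
    next
      fix h u t assume "h \<in> ?S"
      then show "h (u, t + 1) = h (u, t)" by (auto simp: schwartz_RS_periodic)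
    next
      fix h p assume "h \<in> ?S"
      then obtain f g where h: "h = f + g" "f \<in> schwartz_RS" "g \<in> schwartz_RS" by blast
      obtain A where A: "\<And>u t. \<bar>u\<bar> ^ p * norm (f (u, t)) \<le> A"
        using schwartz_RS_bound[OF h(2)] by metis
      obtain B where B: "\<And>u t. \<bar>u\<bar> ^ p * norm (g (u, t)) \<le> B"
        using schwartz_RS_bound[OF h(3)] by metis
      have "\<bar>u\<bar> ^ p * norm (h (u, t)) \<le> A + B" for u t
      proof -
        have "\<bar>u\<bar> ^ p * norm (h (u, t)) \<le> \<bar>u\<bar> ^ p * (norm (f (u, t)) + norm (g (u, t)))"
          unfolding h by (intro mult_left_mono) (auto simp: norm_triangle_ineq)
        then show ?thesis using A[of u t] B[of u t] by (simp add: algebra_simps)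
      qed
      then show "\<exists>C. \<forall>u t. \<bar>u\<bar> ^ p * norm (h (u, t)) \<le> C" by blast
    next
      fix h assume "h \<in> ?S"
      then obtain f g where h: "h = f + g" "f \<in> schwartz_RS" "g \<in> schwartz_RS" by blast
      have "(h has_derivative (\<lambda>s. fst s *\<^sub>R (?u f + ?u g) z + snd s *\<^sub>R (?t f + ?t g) z)) (at z)" for z
        using has_derivative_add[OF D(3)[OF h(2)] D(3)[OF h(3)]] unfolding h plus_fun_def
        by (simp add: algebra_simps scaleR_add_right del: iterated_deriv.simps)
      then show "\<exists>d1\<in>?S. \<exists>d2\<in>?S. \<forall>z. (h has_derivative (\<lambda>s. fst s *\<^sub>R d1 z + snd s *\<^sub>R d2 z)) (at z)"
        using D(1,2) h by blast
    qed
  next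
    fix c f assume f: "f \<in> schwartz_RS"
    let ?S = "scale_fun c ` schwartz_RS"
    show "scale_fun c f \<in> schwartz_RS"
    proof (rule schwartz_RS_coinduct[of _ ?S])
      show "scale_fun c f \<in> ?S" using f by blast
    next
      fix h u t assume "h \<in> ?S"
      then show "h (u, t + 1) = h (u, t)" by (auto simp: schwartz_RS_periodic scale_fun_def)
    next
      fix h p assume "h \<in> ?S"
      then obtain f where h: "h = scale_fun c f" "f \<in> schwartz_RS" by blast
      obtain A where A: "\<And>u t. \<bar>u\<bar> ^ p * norm (f (u, t)) \<le> A"
        using schwartz_RS_bound[OF h(2)] by metis
      have "\<bar>u\<bar> ^ p * norm (h (u, t)) \<le> norm c * A" for u t
        using mult_left_mono[OF A[of u t], of "norm c"]
        by (simp add: h scale_fun_def norm_mult mult_ac)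
      then show "\<exists>C. \<forall>u t. \<bar>u\<bar> ^ p * norm (h (u, t)) \<le> C" by blast
    next
      fix h assume "h \<in> ?S"
      then obtain f where h: "h = scale_fun c f" "f \<in> schwartz_RS" by blast
      have "(h has_derivative (\<lambda>s. fst s *\<^sub>R scale_fun c (?u f) z + snd s *\<^sub>R scale_fun c (?t f) z)) (at z)" for z
        using has_derivative_mult_right[OF D(3)[OF h(2)], of c] unfolding h scale_fun_def
        by (simp add: algebra_simps del: iterated_deriv.simps)
      then show "\<exists>d1\<in>?S. \<exists>d2\<in>?S. \<forall>z. (h has_derivative (\<lambda>s. fst s *\<^sub>R d1 z + snd s *\<^sub>R d2 z)) (at z)"
        using D(1,2) h by blast
    qed
  qed
qed

section \<open>Fourier coefficients and Fourier sums\<close>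


lemma W_powi: "W t powi n = exp (of_real t * (2 * of_real pi * \<i> * of_int n))"
  unfolding W_def by (simp add: exp_power_int mult_ac)

lemma norm_W_powi [simp]: "norm (W t powi n) = 1"
  unfolding W_powi by (simp add: norm_exp_eq_Re)

lemma W_periodic: "W (t + 1) = W t"
  by (simp add: W_def ring_distribs exp_add)

lemma W_powi_has_vector_derivative:
  "((\<lambda>t. W t powi n) has_vector_derivative 2 * of_real pi * \<i> * of_int n * W t powi n) (at t within S)"
proof -
  have "((\<lambda>t. exp (of_real t * c)) has_vector_derivative c * exp (of_real t * c)) (at t within S)"
    for c :: complex
    by (rule has_vector_derivative_real_field) (auto intro!: derivative_eq_intros)
  then show ?thesis unfolding W_powi .
qed

lemma continuous_on_W_powi: "continuous_on S (\<lambda>t. W t powi n)"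
  unfolding W_powi by (intro continuous_intros)

text \<open>Orthogonality of the characters of the circle: for nonzero \<open>n\<close> the
  antiderivative \<open>W t powi n / c\<close> is periodic, so its values at the two ends
  cancel.\<close>

lemma integral_W_powi: "((\<lambda>t. W t powi n) has_integral (if n = 0 then 1 else 0)) {0..1}"
proof (cases "n = 0")
  case True
  then show ?thesis using has_integral_const_real[of "1::complex" 0 1] by simp
next
  case False
  define c where "c = 2 * of_real pi * \<i> * (of_int n :: complex)"
  have c: "c \<noteq> 0" using False by (simp add: c_def)
  have "((\<lambda>t. W t powi n) has_integral (W 1 powi n / c - W 0 powi n / c)) {0..1}"
  proof (rule fundamental_theorem_of_calculus)
    fix t :: real
    have "((\<lambda>t. inverse c * W t powi n) has_vector_derivative inverse c * (c * W t powi n)) (at t within {0..1})"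
      unfolding c_def by (intro has_vector_derivative_mult_right W_powi_has_vector_derivative)
    then show "((\<lambda>t. W t powi n / c) has_vector_derivative W t powi n) (at t within {0..1})"
      using c by (simp add: field_simps)
  qed simp
  then show ?thesis using False W_periodic[of 0] by simp
qed

abbreviation coefs :: "(real \<times> real \<Rightarrow> complex) \<Rightarrow> real \<times> int \<Rightarrow> complex" where
  "coefs f \<equiv> \<lambda>(u, n). coef f n u"

abbreviation du :: "(real \<times> real \<Rightarrow> complex) \<Rightarrow> real \<times> real \<Rightarrow> complex" where
  "du f \<equiv> iterated_deriv [(1, 0)] f"

abbreviation dt :: "(real \<times> real \<Rightarrow> complex) \<Rightarrow> real \<times> real \<Rightarrow> complex" where
  "dt f \<equiv> iterated_deriv [(0, 1)] f"

lemma schwartz_RS_partials: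
  assumes "f \<in> schwartz_RS"
  shows "du f \<in> schwartz_RS" "dt f \<in> schwartz_RS"
    "(f has_derivative (\<lambda>h. fst h *\<^sub>R du f z + snd h *\<^sub>R dt f z)) (at z)"
    "((\<lambda>u. f (u, t)) has_vector_derivative du f (u, t)) (at u within A)"
    "((\<lambda>t. f (u, t)) has_vector_derivative dt f (u, t)) (at t within A)"
    "continuous_on S f"
proof -
  show "du f \<in> schwartz_RS" "dt f \<in> schwartz_RS"
    using assms by (auto intro!: schwartz_RS_iterated_deriv simp: Basis_real_real simp del: iterated_deriv.simps)
  have D: "(f has_derivative (\<lambda>h. fst h *\<^sub>R du f z + snd h *\<^sub>R dt f z)) (at z)" for z
    by (rule has_derivative_partials[OF schwartz_RS_differentiable[OF assms]])
  then show "(f has_derivative (\<lambda>h. fst h *\<^sub>R du f z + snd h *\<^sub>R dt f z)) (at z)" .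
  show "((\<lambda>u. f (u, t)) has_vector_derivative du f (u, t)) (at u within A)"
    unfolding has_vector_derivative_def
    using has_derivative_compose[of "\<lambda>u. (u, t)" "\<lambda>h. (h, 0)" u A, OF _ D]
    by (simp add: has_derivative_Pair has_derivative_ident has_derivative_const del: iterated_deriv.simps)
  show "((\<lambda>t. f (u, t)) has_vector_derivative dt f (u, t)) (at t within A)"
    unfolding has_vector_derivative_def
    using has_derivative_compose[of "\<lambda>t. (u, t)" "\<lambda>h. (0, h)" t A, OF _ D]
    by (simp add: has_derivative_Pair has_derivative_ident has_derivative_const del: iterated_deriv.simps)
  show "continuous_on S f"
    by (meson D continuous_at_imp_continuous_on has_derivative_continuous)
qed

lemma continuous_on_coef_integrand:
  assumes "f \<in> schwartz_RS"
  shows "continuous_on S (\<lambda>t. f (u, t) * W t powi n)"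
proof -
  have "continuous_on S (\<lambda>t. f (u, t))"
    by (rule continuous_on_compose2[OF schwartz_RS_partials(6)[OF assms, of UNIV]])
      (auto intro!: continuous_intros)
  then show ?thesis by (intro continuous_on_mult continuous_on_W_powi)
qed

lemma coef_integrable:
  assumes "f \<in> schwartz_RS"
  shows "(\<lambda>t. f (u, t) * W t powi n) integrable_on {0..1}"
  by (intro integrable_continuous_real continuous_on_coef_integrand assms)

lemma coefs_add:
  assumes "f \<in> schwartz_RS" "g \<in> schwartz_RS"
  shows "coefs (f + g) = coefs f + coefs g"
  using coef_integrable[OF assms(1)] coef_integrable[OF assms(2)]
  by (auto simp: coef_def fun_eq_iff ring_distribs intro!: integral_add)

lemma coefs_scale: "coefs (scale_fun c f) = scale_fun c (coefs f)"
  by (auto simp: coef_def scale_fun_def fun_eq_iff mult.assoc)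

text \<open>Integration by parts over one period; the boundary terms cancel by periodicity.\<close>

lemma coef_dt:
  assumes f: "f \<in> schwartz_RS"
  shows "coef (dt f) n u = 2 * of_real pi * \<i> * of_int n * coef f n u"
proof -
  let ?c = "2 * of_real pi * \<i> * (of_int n :: complex)"
  note D = schwartz_RS_partials[OF f]
  have "((\<lambda>t. f (u, t) * (- ?c * W t powi (- n)) + dt f (u, t) * W t powi (- n)) has_integral
      (f (u, 1) * W 1 powi (- n) - f (u, 0) * W 0 powi (- n))) {0..1}"
  proof (rule fundamental_theorem_of_calculus)
    fix t :: real
    show "((\<lambda>t. f (u, t) * W t powi (- n)) has_vector_derivative
        f (u, t) * (- ?c * W t powi (- n)) + dt f (u, t) * W t powi (- n)) (at t within {0..1})"
      using has_vector_derivative_mult[OF D(5)[of u t "{0..1}"] W_powi_has_vector_derivative[of "- n" t "{0..1}"]]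
      by (simp del: iterated_deriv.simps)
  qed simp
  moreover have "f (u, 1) * W 1 powi (- n) = f (u, 0) * W 0 powi (- n)"
    using schwartz_RS_periodic[OF f, of u 0] W_periodic[of 0] by simp
  ultimately have "((\<lambda>t. - ?c * (f (u, t) * W t powi (- n)) + dt f (u, t) * W t powi (- n)) has_integral 0) {0..1}"
    by (simp add: mult_ac del: iterated_deriv.simps)
  moreover have "((\<lambda>t. - ?c * (f (u, t) * W t powi (- n)) + dt f (u, t) * W t powi (- n)) has_integral
      - ?c * coef f n u + coef (dt f) n u) {0..1}"
    unfolding coef_def
    by (intro has_integral_add has_integral_mult_right integrable_integral coef_integrable f D)
  ultimately have "- ?c * coef f n u + coef (dt f) n u = 0" by (rule has_integral_unique[symmetric])
  then show ?thesis by (simp add: algebra_simps del: iterated_deriv.simps)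
qed

text \<open>Differentiation under the integral over a compact interval, justified by the joint
  continuity of \<open>du f\<close>.\<close>

lemma coef_has_vector_derivative:
  assumes f: "f \<in> schwartz_RS"
  shows "(coef f n has_vector_derivative coef (du f) n u) (at u)"
proof -
  note D = schwartz_RS_partials[OF f]
  have "((\<lambda>u. integral (cbox 0 1) (\<lambda>t. f (u, t) * W t powi (- n))) has_vector_derivative
      integral (cbox 0 1) (\<lambda>t. du f (u, t) * W t powi (- n))) (at u within UNIV)"
  proof (rule leibniz_rule_vector_derivative)
    show "((\<lambda>u. f (u, t) * W t powi (- n)) has_vector_derivative du f (u, t) * W t powi (- n))
        (at u within UNIV)" for u t
      by (intro has_vector_derivative_mult_left D)
    show "(\<lambda>t. f (u, t) * W t powi (- n)) integrable_on cbox 0 1" for u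
      using coef_integrable[OF f] by simp
    have "continuous_on (UNIV \<times> cbox 0 1) (\<lambda>z. W (snd z) powi (- n))"
      by (rule continuous_on_compose2[OF continuous_on_W_powi[of UNIV]]) (auto intro!: continuous_intros)
    then have "continuous_on (UNIV \<times> cbox 0 1) (\<lambda>z. du f z * W (snd z) powi (- n))"
      by (intro continuous_on_mult schwartz_RS_partials(6)[OF D(1)])
    then show "continuous_on (UNIV \<times> cbox 0 1) (\<lambda>(u, t). du f (u, t) * W t powi (- n))"
      by (simp add: case_prod_unfold del: iterated_deriv.simps)
  qed auto
  then show ?thesis unfolding coef_def by (simp del: iterated_deriv.simps)
qed

text \<open>Decay in the frequency comes from regularity in \<open>t\<close>: one power of
  \<open>n\<close> is traded for one derivative \<open>dt\<close>, up to the factor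
  \<open>2 * pi\<close>. The induction therefore varies \<open>f\<close>, and its base case
  estimates the integral by the supremum.\<close>

lemma coef_bound:
  assumes f: "f \<in> schwartz_RS"
  shows "\<exists>C. \<forall>u n. \<bar>u\<bar> ^ p * \<bar>real_of_int n\<bar> ^ q * norm (coef f n u) \<le> C"
  using f
proof (induction q arbitrary: f)
  case 0
  then obtain C where C: "\<And>u t. \<bar>u\<bar> ^ p * norm (f (u, t)) \<le> C"
    using schwartz_RS_bound by metis
  have "\<bar>u\<bar> ^ p * norm (coef f n u) \<le> C" for u n
  proof -
    have "norm (integral {0..1} (\<lambda>t. of_real (\<bar>u\<bar> ^ p) * (f (u, t) * W t powi (- n)))) \<le> C * (1 - 0)"
    proof (rule integral_bound)
      show "continuous_on {0..1} (\<lambda>t. of_real (\<bar>u\<bar> ^ p) * (f (u, t) * W t powi (- n)))"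
        by (intro continuous_on_mult_left continuous_on_coef_integrand 0)
      show "norm (of_real (\<bar>u\<bar> ^ p) * (f (u, t) * W t powi (- n))) \<le> C" for t
        unfolding norm_mult norm_of_real norm_W_powi using C[of u t] by simp
    qed simp
    then show ?thesis
      unfolding coef_def integral_mult_right norm_mult norm_of_real by simp
  qed
  then show ?case by auto
next
  case (Suc q)
  from schwartz_RS_partials(2)[OF Suc.prems] obtain C where
    C: "\<And>u n. \<bar>u\<bar> ^ p * \<bar>real_of_int n\<bar> ^ q * norm (coef (dt f) n u) \<le> C"
    using Suc.IH by blast
  have "\<bar>u\<bar> ^ p * \<bar>real_of_int n\<bar> ^ Suc q * norm (coef f n u) \<le> C / (2 * pi)" for u n
  proof -
    have "norm (coef (dt f) n u) = 2 * pi * \<bar>real_of_int n\<bar> * norm (coef f n u)"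
      unfolding coef_dt[OF Suc.prems] by (simp add: norm_mult)
    with C[of u n] show ?thesis by (simp add: field_simps del: iterated_deriv.simps)
  qed
  then show ?case by blast
qed

text \<open>Taking coefficients commutes with the derivative in \<open>u\<close>, so the coefficient
  sequences form a family fit for coinduction.\<close>

lemma coefs_schwartz_RZ:
  assumes "f \<in> schwartz_RS"
  shows "coefs f \<in> schwartz_RZ"
proof (rule schwartz_RZ_coinduct[of _ "coefs ` schwartz_RS"])
  fix \<eta> assume "\<eta> \<in> coefs ` schwartz_RS"
  then obtain f where f: "f \<in> schwartz_RS" "\<eta> = coefs f" by blast
  then show "decaying \<eta>" using coef_bound by (auto simp: decaying_iff)
  have "\<forall>u n. ((\<lambda>u. \<eta> (u, n)) has_vector_derivative coefs (du f) (u, n)) (at u)"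
    using coef_has_vector_derivative[OF f(1)] f(2) by (simp del: iterated_deriv.simps)
  then show "\<exists>d\<in>coefs ` schwartz_RS. \<forall>u n. ((\<lambda>u. \<eta> (u, n)) has_vector_derivative d (u, n)) (at u)"
    using schwartz_RS_partials(1)[OF f(1)] by blast
qed (use assms in blast)

section \<open>Fourier synthesis: from coefficient sequences back to functions on the
  cylinder\<close>

definition fourier_sum :: "(real \<times> int \<Rightarrow> complex) \<Rightarrow> real \<times> real \<Rightarrow> complex" where
  "fourier_sum c = (\<lambda>(u, t). \<Sum>\<^sub>\<infinity>n. c (u, n) * W t powi n)"

text \<open>The derivative in \<open>t\<close> as it appears on coefficients.\<close>

definition freq_mult :: "(real \<times> int \<Rightarrow> complex) \<Rightarrow> real \<times> int \<Rightarrow> complex" where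
  "freq_mult c = (\<lambda>(u, n). 2 * of_real pi * \<i> * of_int n * c (u, n))"

lemma decaying_freq_mult:
  assumes "decaying c"
  shows "decaying (freq_mult c)"
  unfolding decaying_iff
proof (intro allI)
  fix p q
  obtain C where C: "\<And>u n. \<bar>u\<bar> ^ p * \<bar>real_of_int n\<bar> ^ Suc q * norm (c (u, n)) \<le> C"
    using assms unfolding decaying_iff by metis
  have "\<bar>u\<bar> ^ p * \<bar>real_of_int n\<bar> ^ q * norm (freq_mult c (u, n)) \<le> 2 * pi * C" for u n
    using mult_left_mono[OF C[of u n], of "2 * pi"]
    by (simp add: freq_mult_def norm_mult mult_ac)
  then show "\<exists>C. \<forall>u n. \<bar>u\<bar> ^ p * \<bar>real_of_int n\<bar> ^ q * norm (freq_mult c (u, n)) \<le> C" by blast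
qed

lemma freq_mult_schwartz_RZ:
  assumes "c \<in> schwartz_RZ"
  shows "freq_mult c \<in> schwartz_RZ"
proof (rule schwartz_RZ_coinduct[of _ "freq_mult ` schwartz_RZ"])
  fix \<eta> assume "\<eta> \<in> freq_mult ` schwartz_RZ"
  then obtain c where c: "c \<in> schwartz_RZ" "\<eta> = freq_mult c" by blast
  then show "decaying \<eta>" by (simp add: decaying_freq_mult schwartz_RZ_decaying)
  have "\<forall>u n. ((\<lambda>u. \<eta> (u, n)) has_vector_derivative freq_mult (dx c) (u, n)) (at u)"
    unfolding c(2) freq_mult_def
    by (auto intro!: has_vector_derivative_mult_right schwartz_RZ_has_vector_derivative c(1))
  then show "\<exists>d\<in>freq_mult ` schwartz_RZ. \<forall>u n. ((\<lambda>u. \<eta> (u, n)) has_vector_derivative d (u, n)) (at u)"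
    using schwartz_RZ_dx[OF c(1)] by blast
qed (use assms in blast)

lemma fourier_sum_summable:
  assumes "decaying c"
  shows "(\<lambda>n. c (u, n) * W t powi n) summable_on UNIV"
proof -
  obtain C where C: "\<And>u n. norm (c (u, n)) \<le> C * weight n"
    using decaying_weight_bounded[OF assms] by metis
  show ?thesis by (rule summable_on_weight_bound(2)[of _ C]) (simp add: norm_mult C)
qed

lemma fourier_sum_bound:
  assumes "decaying c"
  shows "\<exists>C. \<forall>u t. \<bar>u\<bar> ^ p * norm (fourier_sum c (u, t)) \<le> C"
proof -
  obtain C where C: "\<And>u n. (1 + \<bar>u\<bar>) ^ p * (1 + \<bar>real_of_int n\<bar>) ^ 0 * norm (c (u, n)) \<le> C * weight n"
    using decaying_weight[OF assms] by metis
  have "\<bar>u\<bar> ^ p * norm (fourier_sum c (u, t)) \<le> C * (\<Sum>\<^sub>\<infinity>n. weight n)" for u t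
  proof -
    have "norm (\<Sum>\<^sub>\<infinity>n. of_real (\<bar>u\<bar> ^ p) * (c (u, n) * W t powi n)) \<le> C * (\<Sum>\<^sub>\<infinity>n. weight n)"
    proof (rule summable_on_weight_bound(3))
      fix n
      have "\<bar>u\<bar> ^ p * norm (c (u, n)) \<le> (1 + \<bar>u\<bar>) ^ p * norm (c (u, n))"
        by (intro mult_right_mono power_mono) auto
      also have "\<dots> \<le> C * weight n" using C[of u n] by simp
      finally show "norm (of_real (\<bar>u\<bar> ^ p) * (c (u, n) * W t powi n)) \<le> C * weight n"
        unfolding norm_mult norm_of_real norm_W_powi by simp
    qed
    then show ?thesis
      unfolding infsum_cmult_right' norm_mult norm_of_real fourier_sum_def by simp
  qed
  then show ?thesis by blast
qed

text \<open>Termwise differentiation in both variables at once. Both partial derivatives are again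
  Fourier sums of sequences in \<open>schwartz_RZ\<close>, which closes the family for
  coinduction.\<close>

lemma fourier_sum_has_derivative:
  assumes c: "c \<in> schwartz_RZ"
  shows "(fourier_sum c has_derivative
    (\<lambda>h. fst h *\<^sub>R fourier_sum (dx c) z + snd h *\<^sub>R fourier_sum (freq_mult c) z)) (at z)"
proof -
  note dx = schwartz_RZ_decaying[OF schwartz_RZ_dx[OF c]]
    and dm = decaying_freq_mult[OF schwartz_RZ_decaying[OF c]]
  obtain A where A: "\<And>u n. norm (dx c (u, n)) \<le> A * weight n"
    using decaying_weight_bounded[OF dx] by metis
  obtain B where B: "\<And>u n. norm (freq_mult c (u, n)) \<le> B * weight n"
    using decaying_weight_bounded[OF dm] by metis
  have "((\<lambda>z. \<Sum>\<^sub>\<infinity>n. c (fst z, n) * W (snd z) powi n) has_derivative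
    (\<lambda>h. \<Sum>\<^sub>\<infinity>n. fst h *\<^sub>R (dx c (fst z, n) * W (snd z) powi n) +
       snd h *\<^sub>R (freq_mult c (fst z, n) * W (snd z) powi n))) (at z)"
  \<comment> \<open>\<open>A\<close> serves the derivative in \<open>u\<close> and \<open>B\<close>
    the one in \<open>t\<close>; each component of \<open>h\<close> is at most
    \<open>norm h\<close>.\<close>
  proof (rule has_derivative_infsum[where M = "\<lambda>n. (A + B) * weight n"])
    fix n and z :: "real \<times> real"
    have 1: "((\<lambda>z. c (fst z, n)) has_derivative (\<lambda>h. fst h *\<^sub>R dx c (fst z, n))) (at z)"
      by (rule has_derivative_compose[OF has_derivative_fst[OF has_derivative_ident]
            schwartz_RZ_has_vector_derivative[OF c, unfolded has_vector_derivative_def]])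
    have 2: "((\<lambda>z. W (snd z) powi n) has_derivative
        (\<lambda>h. snd h *\<^sub>R (2 * of_real pi * \<i> * of_int n * W (snd z) powi n))) (at z)"
      by (rule has_derivative_compose[OF has_derivative_snd[OF has_derivative_ident]
            W_powi_has_vector_derivative[of _ _ UNIV, unfolded has_vector_derivative_def]])
    show "((\<lambda>z. c (fst z, n) * W (snd z) powi n) has_derivative
        (\<lambda>h. fst h *\<^sub>R (dx c (fst z, n) * W (snd z) powi n) +
          snd h *\<^sub>R (freq_mult c (fst z, n) * W (snd z) powi n))) (at z)"
      using has_derivative_mult[OF 1 2] by (simp add: freq_mult_def mult_ac add.commute)
    fix h :: "real \<times> real"
    have "norm (fst h *\<^sub>R (dx c (fst z, n) * W (snd z) powi n) +
          snd h *\<^sub>R (freq_mult c (fst z, n) * W (snd z) powi n)) \<le>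
        norm h * (A * weight n) + norm h * (B * weight n)"
      by (intro norm_triangle_mono)
        (auto simp: norm_mult intro!: mult_mono A B norm_fst_le[of "fst h" "snd h", simplified]
          norm_snd_le[of "snd h" "fst h", simplified])
    then show "norm (fst h *\<^sub>R (dx c (fst z, n) * W (snd z) powi n) +
          snd h *\<^sub>R (freq_mult c (fst z, n) * W (snd z) powi n)) \<le> (A + B) * weight n * norm h"
      by (simp add: algebra_simps)
  qed (auto intro: summable_on_cmult_right summable_weight fourier_sum_summable
        schwartz_RZ_decaying c)
  also have "(\<lambda>z. \<Sum>\<^sub>\<infinity>n. c (fst z, n) * W (snd z) powi n) = fourier_sum c"
    by (simp add: fourier_sum_def case_prod_unfold)
  also have "(\<lambda>h. \<Sum>\<^sub>\<infinity>n. fst h *\<^sub>R (dx c (fst z, n) * W (snd z) powi n) +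
       snd h *\<^sub>R (freq_mult c (fst z, n) * W (snd z) powi n)) =
     (\<lambda>h. fst h *\<^sub>R fourier_sum (dx c) z + snd h *\<^sub>R fourier_sum (freq_mult c) z)"
    unfolding fourier_sum_def case_prod_unfold
    by (simp add: infsum_add infsum_scaleR_right fourier_sum_summable dx dm summable_on_scaleR_right)
  finally show ?thesis .
qed

lemma fourier_sum_schwartz_RS:
  assumes "c \<in> schwartz_RZ"
  shows "fourier_sum c \<in> schwartz_RS"
proof (rule schwartz_RS_coinduct[of _ "fourier_sum ` schwartz_RZ"])
  show "fourier_sum c \<in> fourier_sum ` schwartz_RZ" using assms by blast
next
  fix g u t assume "g \<in> fourier_sum ` schwartz_RZ"
  then show "g (u, t + 1) = g (u, t)" by (auto simp: fourier_sum_def W_periodic)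
next
  fix g p assume "g \<in> fourier_sum ` schwartz_RZ"
  then show "\<exists>C. \<forall>u t. \<bar>u\<bar> ^ p * norm (g (u, t)) \<le> C"
    using fourier_sum_bound schwartz_RZ_decaying by blast
next
  fix g assume "g \<in> fourier_sum ` schwartz_RZ"
  then show "\<exists>d1\<in>fourier_sum ` schwartz_RZ. \<exists>d2\<in>fourier_sum ` schwartz_RZ.
      \<forall>z. (g has_derivative (\<lambda>h. fst h *\<^sub>R d1 z + snd h *\<^sub>R d2 z)) (at z)"
    using fourier_sum_has_derivative schwartz_RZ_dx freq_mult_schwartz_RZ by blast
qed

text \<open>The series converges uniformly in \<open>t\<close>, so it may be integrated term by
  term, and orthogonality leaves only the term of frequency \<open>n\<close>.\<close>

lemma coefs_fourier_sum:
  assumes "decaying c"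
  shows "coefs (fourier_sum c) = c"
proof (intro ext, clarify)
  fix u n
  obtain C where C: "\<And>u n. norm (c (u, n)) \<le> C * weight n"
    using decaying_weight_bounded[OF assms] by metis
  \<comment> \<open>The factor \<open>W t powi (- n)\<close> of the coefficient integral is absorbed
    into the exponent, making frequency \<open>n\<close> the constant term.\<close>
  let ?f = "\<lambda>m t. c (u, m) * W t powi (m - n)"
  have W: "W t powi m * W t powi (- n) = W t powi (m - n)" for t m
    by (simp add: W_def flip: power_int_add)
  have "(\<Sum>\<^sub>\<infinity>m. ?f m t) = fourier_sum c (u, t) * W t powi (- n)" for t
    unfolding fourier_sum_def prod.case infsum_cmult_left'[symmetric] mult.assoc W ..
  moreover have "uniform_limit {0..1} (\<lambda>X t. \<Sum>m\<in>X. ?f m t) (\<lambda>t. \<Sum>\<^sub>\<infinity>m. ?f m t)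
      (finite_subsets_at_top UNIV)"
    by (rule Weierstrass_m_test_general[where M = "\<lambda>m. C * weight m"])
      (auto simp: norm_mult C intro: summable_on_cmult_right summable_weight)
  ultimately have "uniform_limit {0..1} (\<lambda>X t. \<Sum>m\<in>X. ?f m t)
      (\<lambda>t. fourier_sum c (u, t) * W t powi (- n)) (finite_subsets_at_top UNIV)" by simp
  then obtain I J where I: "\<And>X. ((\<lambda>t. \<Sum>m\<in>X. ?f m t) has_integral I X) {0..1}"
    and J: "((\<lambda>t. fourier_sum c (u, t) * W t powi (- n)) has_integral J) {0..1}"
    and lim: "(I \<longlongrightarrow> J) (finite_subsets_at_top UNIV)"
    by (rule uniform_limit_integral)
      (auto intro!: continuous_on_sum continuous_on_mult_left continuous_on_W_powi)
  \<comment> \<open>The integrals of the partial sums are constant once \<open>X\<close> contains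
    \<open>n\<close>. Finiteness excludes the default value 0 of a sum over an infinite set.\<close>
  have "I X = c (u, n)" if "finite X" "n \<in> X" for X
  proof -
    have "((\<lambda>t. \<Sum>m\<in>X. ?f m t) has_integral (\<Sum>m\<in>X. c (u, m) * (if m - n = 0 then 1 else 0))) {0..1}"
      using that by (intro has_integral_sum has_integral_mult_right integral_W_powi)
    from has_integral_unique[OF I this] show ?thesis
      using that by (simp add: if_distrib cong: if_cong)
  qed
  then have "\<forall>\<^sub>F X in finite_subsets_at_top UNIV. I X = c (u, n)"
    unfolding eventually_finite_subsets_at_top by (intro exI[of _ "{n}"]) auto
  then have "(I \<longlongrightarrow> c (u, n)) (finite_subsets_at_top UNIV)" by (rule tendsto_eventually)
  then have "J = c (u, n)" using lim by (metis finite_subsets_at_top_neq_bot tendsto_unique)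
  then show "coef (fourier_sum c) n u = c (u, n)"
    unfolding coef_def using J by (simp add: integral_unique)
qed

section \<open>The bimodule\<close>


lemma cyl_mult_eq: "cyl_mult h f g = fourier_sum (conv h (coefs f) (coefs g))"
  by (auto simp: cyl_mult_def fourier_sum_def twisted_act_def twisted_term_def fun_eq_iff)

lemma left_term_eq: "left_term \<alpha> \<beta> \<epsilon> r f \<xi> = twisted_term \<alpha> \<beta> 0 \<epsilon> r (coefs f) \<xi>"
  by (auto simp: left_term_def twisted_term_def fun_eq_iff)

lemma right_term_eq: "right_term \<alpha> \<beta> h \<epsilon> r \<xi> f = twisted_term \<alpha> \<beta> (- h) \<epsilon> r (coefs f) \<xi>"
  by (auto simp: right_term_def twisted_term_def fun_eq_iff algebra_simps)

lemma left_action_eq: "left_action \<alpha> \<beta> \<epsilon> r f \<xi> = twisted_act \<alpha> \<beta> 0 \<epsilon> r (coefs f) \<xi>"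
  by (simp add: left_action_def twisted_act_def left_term_eq)

lemma right_action_eq: "right_action \<alpha> \<beta> h \<epsilon> r \<xi> f = twisted_act \<alpha> \<beta> (- h) \<epsilon> r (coefs f) \<xi>"
  by (simp add: right_action_def twisted_act_def right_term_eq)

lemma coefs_decaying: "f \<in> schwartz_RS \<Longrightarrow> decaying (coefs f)"
  by (intro schwartz_RZ_decaying coefs_schwartz_RZ)

lemma cyl_mult_schwartz_RS:
  assumes "f \<in> schwartz_RS" "g \<in> schwartz_RS"
  shows "cyl_mult h f g \<in> schwartz_RS"
  unfolding cyl_mult_eq
  by (intro fourier_sum_schwartz_RS twisted_act_schwartz_RZ coefs_schwartz_RZ assms)

text \<open>The product is by definition the Fourier sum of a decaying sequence, so that sequence is
  recovered as its coefficients. Iterated products can thus be computed on sequences.\<close>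

lemma coefs_cyl_mult:
  assumes "f \<in> schwartz_RS" "g \<in> schwartz_RS"
  shows "coefs (cyl_mult h f g) = conv h (coefs f) (coefs g)"
  unfolding cyl_mult_eq
  by (intro coefs_fourier_sum decaying_twisted_act coefs_decaying assms)

lemma fourier_sum_add:
  assumes "decaying c" "decaying d"
  shows "fourier_sum (c + d) = fourier_sum c + fourier_sum d"
  using fourier_sum_summable[OF assms(1)] fourier_sum_summable[OF assms(2)]
  by (auto simp: fourier_sum_def fun_eq_iff ring_distribs intro!: infsum_add)

lemma fourier_sum_scale: "fourier_sum (scale_fun s c) = scale_fun s (fourier_sum c)"
  by (auto simp: fourier_sum_def scale_fun_def fun_eq_iff mult.assoc infsum_cmult_right')

lemma nonunital_algebra_cyl_mult: "nonunital_algebra scale_fun schwartz_RS (cyl_mult h)"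
proof -
  interpret vector_space scale_fun by (rule vector_space_scale_fun)
  note d = coefs_decaying
  show ?thesis
  proof
    fix a b c assume abc: "a \<in> schwartz_RS" "b \<in> schwartz_RS" "c \<in> schwartz_RS"
    show "cyl_mult h (a + b) c = cyl_mult h a c + cyl_mult h b c"
      "cyl_mult h a (b + c) = cyl_mult h a b + cyl_mult h a c"
      unfolding cyl_mult_eq
      by (simp_all add: coefs_add abc twisted_act_bilinear(1)[OF d d d d, OF abc(1,2,3,3)]
          twisted_act_bilinear(2)[OF d d d d, OF abc(1,1,2,3)] fourier_sum_add decaying_twisted_act d)
    \<comment> \<open>The left module law for the action of sequences on themselves; its numerical
      condition reads \<open>1 * (- h) + 0 * 1 = - h\<close>.\<close>
    have "conv h (coefs (cyl_mult h a b)) (coefs c) = conv h (coefs a) (coefs (cyl_mult h b c))"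
      unfolding coefs_cyl_mult[OF abc(1,2)] coefs_cyl_mult[OF abc(2,3)]
      by (intro twisted_act_conv_left d abc) simp
    then show "cyl_mult h (cyl_mult h a b) c = cyl_mult h a (cyl_mult h b c)"
      by (simp only: cyl_mult_eq[of h "cyl_mult h a b"] cyl_mult_eq[of h a "cyl_mult h b c"])
  next
    fix a b s assume ab: "a \<in> schwartz_RS" "b \<in> schwartz_RS"
    show "cyl_mult h (scale_fun s a) b = scale_fun s (cyl_mult h a b)"
      "cyl_mult h a (scale_fun s b) = scale_fun s (cyl_mult h a b)"
      unfolding cyl_mult_eq coefs_scale
      by (simp_all add: twisted_act_bilinear(3)[OF d d d d, OF ab(1) ab(1) ab(2) ab(2)]
          twisted_act_bilinear(4)[OF d d d d, OF ab(1) ab(1) ab(2) ab(2)] fourier_sum_scale)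
  qed (auto intro: subspace_schwartz_RS cyl_mult_schwartz_RS)
qed

theorem proposition4p3:
  fixes lam0 mu0 lam1 mu1 eps eps' hbar hbar' :: real and r r' :: int
  assumes "lam0 * eps + lam1 * of_int r = - hbar"
    and "mu0 * eps' + mu1 * of_int r' = hbar'"
    and "lam0 * eps' + lam1 * of_int r' = 0"
    and "mu0 * eps + mu1 * of_int r = 0"
  shows "(\<forall>f \<in> schwartz_RS. \<forall>\<xi> \<in> schwartz_RZ. \<forall>x k.
            left_term lam0 lam1 eps r f \<xi> x k summable_on UNIV \<and>
            right_term mu0 mu1 hbar' eps' r' \<xi> f x k summable_on UNIV) \<and>
         bimodule scale_fun schwartz_RS (cyl_mult hbar)
                  scale_fun schwartz_RS (cyl_mult hbar')
                  scale_fun schwartz_RZ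
                  (left_action lam0 lam1 eps r) (right_action mu0 mu1 hbar' eps' r')"
proof (intro conjI ballI allI)
  fix f \<xi> x k assume "f \<in> schwartz_RS" "\<xi> \<in> schwartz_RZ"
  then show "left_term lam0 lam1 eps r f \<xi> x k summable_on UNIV"
    "right_term mu0 mu1 hbar' eps' r' \<xi> f x k summable_on UNIV"
    unfolding left_term_eq right_term_eq
    by (auto intro: twisted_term_summable coefs_decaying schwartz_RZ_decaying)
next
  interpret A: nonunital_algebra scale_fun schwartz_RS "cyl_mult hbar"
    by (rule nonunital_algebra_cyl_mult)
  interpret B: nonunital_algebra scale_fun schwartz_RS "cyl_mult hbar'"
    by (rule nonunital_algebra_cyl_mult)
  interpret V: vector_space scale_fun
    by (rule vector_space_scale_fun)
  note d = coefs_decaying schwartz_RZ_decaying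
  note actions = left_action_eq right_action_eq
  show "bimodule scale_fun schwartz_RS (cyl_mult hbar)
                  scale_fun schwartz_RS (cyl_mult hbar')
                  scale_fun schwartz_RZ
                  (left_action lam0 lam1 eps r) (right_action mu0 mu1 hbar' eps' r')"
  proof (unfold_locales, unfold actions)
    fix a a' :: "real \<times> real \<Rightarrow> complex" and \<xi> \<eta> :: "real \<times> int \<Rightarrow> complex" and s
    assume a: "a \<in> schwartz_RS" and \<xi>: "\<xi> \<in> schwartz_RZ"
    note bil = twisted_act_bilinear[OF d(1) d(1) d(2) d(2), OF a _ \<xi>]
    \<comment> \<open>Both actions are now twisted actions of coefficient sequences, so the axioms
      of both sides can be treated side by side.\<close>
    let ?L = "twisted_act lam0 lam1 0 eps r" and ?R = "twisted_act mu0 mu1 (- hbar') eps' r'"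
    show "?L (coefs a) \<xi> \<in> schwartz_RZ" "?R (coefs a) \<xi> \<in> schwartz_RZ"
      by (intro twisted_act_schwartz_RZ coefs_schwartz_RZ a \<xi>)+
    show "?L (coefs (scale_fun s a)) \<xi> = scale_fun s (?L (coefs a) \<xi>)"
      "?R (coefs (scale_fun s a)) \<xi> = scale_fun s (?R (coefs a) \<xi>)"
      "?L (coefs a) (scale_fun s \<xi>) = scale_fun s (?L (coefs a) \<xi>)"
      "?R (coefs a) (scale_fun s \<xi>) = scale_fun s (?R (coefs a) \<xi>)"
      by (simp_all add: coefs_scale bil(3,4)[OF a \<xi>])
    show "?L (coefs a) (\<xi> + \<eta>) = ?L (coefs a) \<xi> + ?L (coefs a) \<eta>"
      "?R (coefs a) (\<xi> + \<eta>) = ?R (coefs a) \<xi> + ?R (coefs a) \<eta>" if "\<eta> \<in> schwartz_RZ"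
      using bil(2)[OF a that] by simp_all
    assume a': "a' \<in> schwartz_RS"
    show "?L (coefs (a + a')) \<xi> = ?L (coefs a) \<xi> + ?L (coefs a') \<xi>"
      "?R (coefs (a + a')) \<xi> = ?R (coefs a) \<xi> + ?R (coefs a') \<xi>"
      by (simp_all add: coefs_add a a' bil(1)[OF a' \<xi>])
    show "?L (coefs (cyl_mult hbar a a')) \<xi> = ?L (coefs a) (?L (coefs a') \<xi>)"
      unfolding coefs_cyl_mult[OF a a'] by (intro twisted_act_conv_left d a a' \<xi> assms(1))
    \<comment> \<open>For a right action the first factor of the product acts first.\<close>
    show "?R (coefs (cyl_mult hbar' a a')) \<xi> = ?R (coefs a') (?R (coefs a) \<xi>)"
      unfolding coefs_cyl_mult[OF a a'] by (intro twisted_act_conv_right d a a' \<xi> assms(2))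
    \<comment> \<open>The two vanishing conditions say that each action preserves the linear form at
      which the coefficients of the other are read.\<close>
    show "?R (coefs a') (?L (coefs a) \<xi>) = ?L (coefs a) (?R (coefs a') \<xi>)"
      by (intro twisted_act_commute d a a' \<xi> assms(3,4))
  qed (rule subspace_schwartz_RZ)
qed

end
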